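(* For $d\in\mathbb{N}$ and $t\ge0$ put $$I_d(x;t):=\sum_{k=0}^d(-1)^k\binom dk\exp\Big(\frac{k(d-k)}{2d}t\Big)x^{d-k}.$$ (1) (Central limit theorem) Let $d\ge2$ and let $p(x)=\prod_{k=1}^d(x-e^{\theta_k})$ with $\theta_1,\dots,\theta_d\in\mathbb{R}$ such that $\frac1d\sum_{k=1}^d\theta_k=0$ and $\frac1d\sum_{k=1}^d\theta_k^2=\sigma^2$. Then $$\lim_{m\to\infty}\phi_{1/\sqrt m}(p)^{\boxtimes_d m}(x)=I_d\Big(x;\frac{d\sigma^2}{d-1}\Big).$$ (2) For every $t\ge0$, as $d\to\infty$, $\mu\llbracket I_d(x;t)\rrbracket$ converges weakly to $\lambda_t$, the multiplicative free semicircular distribution.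
   Context: For a monic polynomial $p$ of degree $d$ write $p(x)=\sum_{i=0}^d(-1)^i\binom{d}{i}\widetilde a_i(p)x^{d-i}$, which defines $\widetilde a_i(p)$. The finite free multiplicative convolution of monic $p,q$ of degree $d$ is $(p\boxtimes_d q)(x)=\sum_{i=0}^d(-1)^i\binom di\widetilde a_i(p)\widetilde a_i(q)x^{d-i}$, and $p^{\boxtimes_d m}$ is the $m$-fold power. For a monic polynomial $p(x)=\prod_{k=1}^d(x-\lambda_k)$ with nonnegative roots and $\alpha>0$, $\phi_\alpha(p)(x)=\prod_{k=1}^d(x-\lambda_k^\alpha)$. Limits of polynomials of fixed degree are coefficientwise. The empirical root distribution of $p(x)=\prod_{k=1}^d(x-\lambda_k)$ is $\mu\llbracket p\rrbracket=\frac1d\sum_{k=1}^d\delta_{\lambda_k}$. The multiplicative free semicircular distribution $\lambda_t$, $t\ge0$, is the compactly supported probability measure on $[0,\infty)$ with $n$-th moment $\exp\left(\frac{nt}{2}\right)\sum_{k=0}^{n-1}\frac{n^{k-1}}{k!}\binom{n}{k+1}t^k$ for $n\in\mathbb{N}$; equivalently its S-transform is $S_{\lambda_t}(z)=\exp(-t(z+\frac12))$. *)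

theory Defs
  imports "HOL-Probability.Probability" "HOL-Computational_Algebra.Computational_Algebra"
begin

definition atilde :: "nat \<Rightarrow> 'a::field_char_0 poly \<Rightarrow> nat \<Rightarrow> 'a" where
  "atilde d p i = (-1) ^ i * coeff p (d - i) / of_nat (d choose i)"

definition ffmc :: "nat \<Rightarrow> 'a::field_char_0 poly \<Rightarrow> 'a poly \<Rightarrow> 'a poly" where
  "ffmc d p q = (\<Sum>i\<le>d. monom ((-1) ^ i * of_nat (d choose i) * atilde d p i * atilde d q i) (d - i))"

text \<open>The zeroth power is the unit of the convolution on monic polynomials of degree \<open>d\<close>.\<close>

primrec ffmc_power :: "nat \<Rightarrow> 'a::field_char_0 poly \<Rightarrow> nat \<Rightarrow> 'a poly" where
  "ffmc_power d p 0 = [:-1, 1:] ^ d"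
| "ffmc_power d p (Suc m) = ffmc d (ffmc_power d p m) p"

text \<open>Intended for monic \<open>p\<close> with nonnegative roots only and \<open>\<alpha> > 0\<close>; note that \<open>0 powr \<alpha> = 0\<close>.\<close>

definition root_power :: "real \<Rightarrow> real poly \<Rightarrow> real poly" where
  "root_power \<alpha> p = (\<Prod>x\<in>#proots p. [:- (x powr \<alpha>), 1:])"

definition I_poly :: "nat \<Rightarrow> real \<Rightarrow> real poly" where
  "I_poly d t = (\<Sum>k\<le>d. monom ((-1) ^ k * real (d choose k)
     * exp (real k * real (d - k) / (2 * real d) * t)) (d - k))"

text \<open>
  Each root is weighted by its multiplicity divided by the number of real roots counted with
  multiplicity. This is the empirical root distribution when \<open>p\<close> has positive degree and splits
  over the reals.
\<close>

definition root_dist :: "real poly \<Rightarrow> real measure" where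
  "root_dist p = distr (measure_pmf (pmf_of_multiset (proots p))) borel (\<lambda>x. x)"

text \<open>
  The exponent \<open>k - 1\<close> is an integer: the summand for \<open>k = 0\<close> carries the factor \<open>1 / n\<close>.
  A compactly supported measure is determined by its moments, which makes the description unique.
\<close>

definition mult_free_semicircular :: "real \<Rightarrow> real measure" where
  "mult_free_semicircular t = (THE M. real_distribution M
     \<and> (\<exists>K. compact K \<and> K \<subseteq> {0..} \<and> measure M K = 1)
     \<and> (\<forall>n\<ge>1. (\<integral>x. x ^ n \<partial>M) =
          exp (real n * t / 2) *
          (\<Sum>k<n. real n powi (int k - 1) / fact k * real (n choose (k + 1)) * t ^ k)))"

end

theory Submission
  imports Defs "HOL-Real_Asymp.Real_Asymp"
begin

text \<open>
  \<^emph>\<open>Central limit theorem.\<close> The normalised coefficients are multiplicative under the convolution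
  (\<open>atilde_ffmc_power\<close>). For a polynomial with roots \<open>exp (\<theta> k / sqrt m)\<close> the \<open>i\<close>-th one is the average of
  \<open>exp (\<theta>\<^sub>S / sqrt m)\<close> over all \<open>i\<close>-element sets \<open>S\<close>, where \<open>\<theta>\<^sub>S\<close> is the sum of \<open>\<theta>\<close> over \<open>S\<close>. Since \<open>\<theta>\<close> has
  mean 0, the average of \<open>\<theta>\<^sub>S\<close> vanishes and that of \<open>\<theta>\<^sub>S\<^sup>2\<close> is \<open>\<sigma>\<^sup>2 i (d - i) / (d - 1)\<close>
  (\<open>sum_subset_sums_squared\<close>). Hence the \<open>m\<close>-th power tends to the exponential of half this number.

  \<^emph>\<open>Real roots.\<close> \<open>I_poly d t\<close> arises from a power of a linear polynomial by multiplying the \<open>j\<close>-th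
  coefficient with \<open>exp (- c j\<^sup>2)\<close>. This multiplier is a limit of products of operators \<open>1 + s x D\<close>, each
  of which preserves polynomials with positive roots, as one sees from the sign of the imaginary part
  of the logarithmic derivative (\<open>pos_rooted_euler_shift\<close>, \<open>I_poly_splits\<close>).

  \<^emph>\<open>Large degree.\<close> The coefficients of \<open>I_poly d t\<close> satisfy a heat-type equation in \<open>t\<close>. The generating
  series of the root moments is a logarithmic derivative, so it satisfies a viscous Burgers equation
  with viscosity of order \<open>1 / d\<close> (\<open>root_moment_fps_deriv\<close>). The moments of the multiplicative free
  semicircular law satisfy the inviscid equation (\<open>semicircular_moment_deriv\<close>); this rests on a
  Lagrange inversion formula, again proved by differentiating in \<open>t\<close>
  (\<open>lagrange_power_coeff_power\<close>). Both systems are triangular, so the moments are compared one after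
  the other (\<open>root_moments_converge\<close>): root moments converge to, and never exceed, the semicircular
  ones. The latter grow geometrically, which bounds all roots uniformly in \<open>d\<close>. The method of moments
  on a compact interval then produces the limit law and identifies it
  (\<open>moments_converge_imp_weak_conv\<close>).
\<close>

section \<open>The central limit theorem in fixed degree\<close>

text \<open>
  A version of the limit \<open>(1 + c / m) ^ m \<longlonglongrightarrow> exp c\<close> that allows \<open>c\<close> to vary with \<open>m\<close>.
\<close>

lemma tendsto_power_one_plus_divide:
  fixes y :: "nat \<Rightarrow> real"
  assumes y: "y \<longlonglongrightarrow> c"
  shows "(\<lambda>m. (1 + y m / real m) ^ m) \<longlonglongrightarrow> exp c"
proof -
  have u: "(\<lambda>m. y m / real m) \<longlonglongrightarrow> 0"
    using tendsto_mult[OF y lim_inverse_n'] by (simp add: field_simps)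
  have "\<forall>\<^sub>F m in sequentially. \<bar>y m / real m\<bar> < 1/2"
    using tendstoD[OF u, of "1/2"] by (simp add: dist_real_def)
  hence ev: "\<forall>\<^sub>F m in sequentially. \<bar>y m / real m\<bar> < 1/2 \<and> m > 0"
    using eventually_gt_at_top[of 0] by eventually_elim auto
  have "(\<lambda>m. 2 * (y m * (y m / real m))) \<longlonglongrightarrow> 2 * (c * 0)"
    by (intro tendsto_intros y u)
  hence z: "(\<lambda>m. 2 * (y m * (y m / real m))) \<longlonglongrightarrow> 0" by simp
  have "(\<lambda>m. real m * ln (1 + y m / real m) - y m) \<longlonglongrightarrow> 0"
  proof (rule tendsto_rabs_zero_cancel, rule tendsto_sandwich[OF _ _ tendsto_const z])
    show "\<forall>\<^sub>F m in sequentially. \<bar>real m * ln (1 + y m / real m) - y m\<bar> \<le> 2 * (y m * (y m / real m))"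
      using ev
    proof eventually_elim
      case (elim m)
      let ?u = "y m / real m"
      have "real m * ln (1 + ?u) - y m = real m * (ln (1 + ?u) - ?u)"
        using elim by (simp add: right_diff_distrib)
      hence "\<bar>real m * ln (1 + ?u) - y m\<bar> = real m * \<bar>ln (1 + ?u) - ?u\<bar>"
        by (simp add: abs_mult)
      also have "\<dots> \<le> real m * (2 * ?u\<^sup>2)"
        using elim abs_ln_one_plus_x_minus_x_bound[of ?u] by (intro mult_left_mono) auto
      also have "\<dots> = 2 * (y m * ?u)"
        using elim by (simp add: power2_eq_square)
      finally show ?case .
    qed
  qed auto
  from tendsto_add[OF this y] have "(\<lambda>m. real m * ln (1 + y m / real m)) \<longlonglongrightarrow> c" by simp
  hence "(\<lambda>m. exp (real m * ln (1 + y m / real m))) \<longlonglongrightarrow> exp c"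
    by (intro tendsto_intros)
  thus ?thesis
  proof (rule Lim_transform_eventually)
    show "\<forall>\<^sub>F m in sequentially. exp (real m * ln (1 + y m / real m)) = (1 + y m / real m) ^ m"
      using ev
    proof eventually_elim
      case (elim m)
      hence "1 + y m / real m > 0" by linarith
      thus ?case by (simp add: exp_of_nat_mult)
    qed
  qed
qed

text \<open>
  Second-order Taylor expansion of \<open>exp\<close>. The argument \<open>x / sqrt m\<close> comes from raising the roots to
  the power \<open>1 / sqrt m\<close>.
\<close>

lemma exp_second_order_limit:
  "(\<lambda>m. real m * (exp (x / sqrt (real m)) - 1 - x / sqrt (real m))) \<longlonglongrightarrow> x\<^sup>2 / 2"
proof -
  consider "x = 0" | "x > 0" | "x < 0" by linarith
  thus ?thesis
  proof cases
    case 2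
    hence "(\<lambda>m. real m * (exp (x / sqrt (real m)) - 1 - x / sqrt (real m))) \<longlonglongrightarrow> x * x / 2"
      by real_asymp
    thus ?thesis by (simp add: power2_eq_square)
  next
    case 3
    hence "(\<lambda>m. real m * (exp (x / sqrt (real m)) - 1 - x / sqrt (real m))) \<longlonglongrightarrow> x * x / 2"
      by real_asymp
    thus ?thesis by (simp add: power2_eq_square)
  qed simp
qed

lemma coeff_prod_linear:
  fixes a :: "'b \<Rightarrow> 'a::comm_ring_1"
  assumes A: "finite A" and i: "i \<le> card A"
  shows "coeff (\<Prod>k\<in>A. [:- a k, 1:]) (card A - i)
         = (-1) ^ i * (\<Sum>S | S \<subseteq> A \<and> card S = i. \<Prod>k\<in>S. a k)"
proof -
  have P: "(\<Prod>k\<in>S. [:a k:]) = [:\<Prod>k\<in>S. a k:]" if "finite S" for S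
    using that by (induction S rule: finite_induct) auto
  have X: "[:0, 1:] ^ n = monom (1::'a) n" for n
    by (simp add: monom_altdef)
  have "(\<Prod>k\<in>A. [:- a k, 1:]) = (\<Prod>k\<in>A. [:0, 1:] - [:a k:])" by simp
  also have "\<dots> = (\<Sum>S\<in>Pow A. (-1) ^ card S * (\<Prod>k\<in>S. [:a k:]) * (\<Prod>k\<in>A-S. [:0, 1:]))"
    by (rule prod_diff_conv_sum[OF A])
  also have "\<dots> = (\<Sum>S\<in>Pow A. monom ((-1) ^ card S * (\<Prod>k\<in>S. a k)) (card A - card S))"
  proof (rule sum.cong)
    fix S assume "S \<in> Pow A"
    hence S: "finite S" "card (A - S) = card A - card S"
      using rev_finite_subset[OF A] by (auto simp: card_Diff_subset)
    have m1: "(-1) ^ n = [:(-1::'a) ^ n:]" for n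
      by (induction n) (auto simp: one_pCons)
    show "(-1) ^ card S * (\<Prod>k\<in>S. [:a k:]) * (\<Prod>k\<in>A-S. [:0, 1:])
        = monom ((-1) ^ card S * (\<Prod>k\<in>S. a k)) (card A - card S)"
      by (simp add: P S X m1 smult_monom)
  qed simp
  finally have eq: "(\<Prod>k\<in>A. [:- a k, 1:]) = \<dots>" .
  have "coeff (\<Prod>k\<in>A. [:- a k, 1:]) (card A - i)
      = (\<Sum>S\<in>Pow A. if card S = i then (-1) ^ card S * (\<Prod>k\<in>S. a k) else 0)"
    unfolding eq coeff_sum coeff_monom
  proof (rule sum.cong)
    fix S assume "S \<in> Pow A"
    hence "card S \<le> card A" using A by (auto intro: card_mono)
    thus "(if card A - card S = card A - i then (-1) ^ card S * (\<Prod>k\<in>S. a k) else 0)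
       = (if card S = i then (-1) ^ card S * (\<Prod>k\<in>S. a k) else 0)"
      using i by auto
  qed simp
  also have "\<dots> = (\<Sum>S | S \<subseteq> A \<and> card S = i. (-1) ^ card S * (\<Prod>k\<in>S. a k))"
    using A by (subst sum.inter_filter[symmetric]) (auto simp: Pow_def)
  also have "\<dots> = (-1) ^ i * (\<Sum>S | S \<subseteq> A \<and> card S = i. \<Prod>k\<in>S. a k)"
    unfolding sum_distrib_left by (rule sum.cong) auto
  finally show ?thesis .
qed

text \<open>
  By Vieta, the normalised coefficient is the average, over all \<open>i\<close>-element sets of roots, of the
  product of the roots in the set. For roots \<open>exp (s * \<theta> k)\<close> it is therefore an average of
  exponentials, which has an explicit expansion in \<open>s\<close>.
\<close>

lemma atilde_prod_linear:
  fixes a :: "nat \<Rightarrow> 'a::field_char_0"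
  assumes "i \<le> d"
  shows "atilde d (\<Prod>k=1..d. [:- a k, 1:]) i
         = (\<Sum>S | S \<subseteq> {1..d} \<and> card S = i. \<Prod>k\<in>S. a k) / of_nat (d choose i)"
  unfolding atilde_def using coeff_prod_linear[of "{1..d}" i a] assms
  by simp

lemma atilde_unit: "i \<le> d \<Longrightarrow> atilde d ([:-1, 1:] ^ d) i = (1::'a::field_char_0)"
  using atilde_prod_linear[of i d "\<lambda>_. 1::'a"] n_subsets[of "{1..d}" i] by simp

lemma coeff_conv_atilde:
  "j \<le> d \<Longrightarrow> coeff p j = (-1) ^ (d - j) * of_nat (d choose (d - j)) * atilde d p (d - j)"
  by (simp add: atilde_def)

lemma coeff_ffmc:
  "coeff (ffmc d p q) j = (if j \<le> d then
     (-1) ^ (d - j) * of_nat (d choose (d - j)) * atilde d p (d - j) * atilde d q (d - j) else 0)"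
proof -
  have "coeff (ffmc d p q) j = (\<Sum>i\<le>d. if i = d - j \<and> j \<le> d then
     (-1) ^ i * of_nat (d choose i) * atilde d p i * atilde d q i else 0)"
    unfolding ffmc_def coeff_sum coeff_monom by (intro sum.cong) auto
  thus ?thesis by auto
qed

lemma atilde_ffmc: "i \<le> d \<Longrightarrow> atilde d (ffmc d p q) i = atilde d p i * atilde d q i"
  unfolding atilde_def[of d "ffmc d p q"] coeff_ffmc
  by simp

text \<open>
  The convolution multiplies normalised coefficients, so convolution powers are ordinary powers of
  numbers.
\<close>

lemma atilde_ffmc_power: "i \<le> d \<Longrightarrow> atilde d (ffmc_power d p m) i = atilde d p i ^ m"
  by (induction m) (auto simp: atilde_unit atilde_ffmc)

lemma coeff_ffmc_power:
  "coeff (ffmc_power d p m) j = (if j \<le> d then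
     (-1) ^ (d - j) * of_nat (d choose (d - j)) * atilde d p (d - j) ^ m else 0)"
proof (cases "j \<le> d")
  case True
  thus ?thesis
    using atilde_ffmc_power[of "d - j" d p m] coeff_conv_atilde[of j d "ffmc_power d p m"] by simp
next
  case False
  have "degree ([:-1, 1:] ^ d :: 'a poly) = d" by (simp add: degree_linear_power)
  with False show ?thesis
    by (cases m) (auto simp: coeff_ffmc coeff_eq_0)
qed

lemma coeff_I_poly:
  "coeff (I_poly d t) j = (if j \<le> d then
     (-1) ^ (d - j) * real (d choose (d - j)) * exp (real (d - j) * real j / (2 * real d) * t) else 0)"
proof -
  have "coeff (I_poly d t) j = (\<Sum>k\<le>d. if k = d - j \<and> j \<le> d then
     (-1) ^ k * real (d choose k) * exp (real k * real (d - k) / (2 * real d) * t) else 0)"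
    unfolding I_poly_def coeff_sum coeff_monom by (intro sum.cong) auto
  thus ?thesis by auto
qed

lemma root_power_prod_exp:
  assumes "finite A"
  shows "root_power \<alpha> (\<Prod>k\<in>A. [:- exp (\<theta> k), 1:]) = (\<Prod>k\<in>A. [:- exp (\<alpha> * \<theta> k), 1:])"
proof -
  have "proots (\<Prod>k\<in>A. [:- exp (\<theta> k), 1:]) = image_mset (\<lambda>k. exp (\<theta> k)) (mset_set A)"
    by (subst proots_prod) (auto simp: sum_unfold_sum_mset)
  thus ?thesis
    unfolding root_power_def
    by (simp add: multiset.map_comp o_def exp_powr_real prod_unfold_prod_mset mult.commute)
qed

text \<open>
  The number does not depend on the pair, which is what makes the double count of
  \<open>sum_subset_sums_squared\<close> work.
\<close>

lemma card_subsets_separating: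
  assumes A: "finite A" and ab: "a \<in> A" "b \<in> A" "a \<noteq> b" and i: "i \<ge> 1"
  shows "card {S. S \<subseteq> A \<and> card S = i \<and> a \<in> S \<and> b \<notin> S} = (card A - 2) choose (i - 1)"
proof -
  have "bij_betw (insert a) {T. T \<subseteq> A - {a, b} \<and> card T = i - 1}
          {S. S \<subseteq> A \<and> card S = i \<and> a \<in> S \<and> b \<notin> S}"
  proof (rule bij_betw_byWitness[of _ "\<lambda>S. S - {a}"])
    show "insert a ` {T. T \<subseteq> A - {a, b} \<and> card T = i - 1}
            \<subseteq> {S. S \<subseteq> A \<and> card S = i \<and> a \<in> S \<and> b \<notin> S}"
    proof safe
      fix T assume "T \<subseteq> A - {a, b}" "card T = i - 1"
      thus "card (insert a T) = i"
        using rev_finite_subset[OF A, of T] i by (subst card_insert_disjoint) auto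
    qed (use ab in auto)
    show "(\<lambda>S. S - {a}) ` {S. S \<subseteq> A \<and> card S = i \<and> a \<in> S \<and> b \<notin> S}
            \<subseteq> {T. T \<subseteq> A - {a, b} \<and> card T = i - 1}"
      by auto
  qed auto
  from bij_betw_same_card[OF this] have "card {S. S \<subseteq> A \<and> card S = i \<and> a \<in> S \<and> b \<notin> S}
     = card {T. T \<subseteq> A - {a, b} \<and> card T = i - 1}" by simp
  also have "\<dots> = card (A - {a, b}) choose (i - 1)"
    using A by (intro n_subsets) auto
  also have "card (A - {a, b}) = card A - 2"
    using A ab by (subst card_Diff_subset) auto
  finally show ?thesis .
qed

text \<open>
  Every element of \<open>A\<close> lies in the same number of \<open>i\<close>-subsets, so the left-hand side is a multiple
  of \<open>sum f A\<close>.
\<close>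

lemma sum_subset_sums_eq_0:
  fixes f :: "'b \<Rightarrow> real"
  assumes A: "finite A" and f: "sum f A = 0"
  shows "(\<Sum>S | S \<subseteq> A \<and> card S = i. sum f S) = 0"
proof (cases "i = 0")
  case True
  have "(\<Sum>S | S \<subseteq> A \<and> card S = i. sum f S) = (\<Sum>S\<in>{{}}. sum f S)"
    using A True by (intro sum.cong) (auto dest: rev_finite_subset[OF A])
  thus ?thesis by simp
next
  case False
  let ?\<S> = "{S. S \<subseteq> A \<and> card S = i}"
  have fin: "finite ?\<S>" by (rule finite_subset[of _ "Pow A"]) (use A in auto)
  have card: "card {S \<in> ?\<S>. a \<in> S} = (card A - 1) choose (i - 1)" if a: "a \<in> A" for a
  proof -
    have "bij_betw (insert a) {T. T \<subseteq> A - {a} \<and> card T = i - 1} {S \<in> ?\<S>. a \<in> S}"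
    proof (rule bij_betw_byWitness[of _ "\<lambda>S. S - {a}"])
      show "insert a ` {T. T \<subseteq> A - {a} \<and> card T = i - 1} \<subseteq> {S \<in> ?\<S>. a \<in> S}"
      proof safe
        fix T assume "T \<subseteq> A - {a}" "card T = i - 1"
        thus "card (insert a T) = i"
          using rev_finite_subset[OF A, of T] False by (subst card_insert_disjoint) auto
      qed (use a in auto)
      show "(\<lambda>S. S - {a}) ` {S \<in> ?\<S>. a \<in> S} \<subseteq> {T. T \<subseteq> A - {a} \<and> card T = i - 1}"
        by auto
    qed auto
    from bij_betw_same_card[OF this] show ?thesis
      using A a n_subsets[of "A - {a}" "i - 1"] by simp
  qed
  have "(\<Sum>S\<in>?\<S>. sum f S) = (\<Sum>S\<in>?\<S>. \<Sum>a | a \<in> A \<and> a \<in> S. f a)"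
    by (intro sum.cong) (auto intro!: sum.cong)
  also have "\<dots> = (\<Sum>a\<in>A. \<Sum>S | S \<in> ?\<S> \<and> a \<in> S. f a)"
    by (rule sum.swap_restrict[OF fin A])
  also have "\<dots> = real ((card A - 1) choose (i - 1)) * sum f A"
    unfolding sum_distrib_left by (intro sum.cong) (use card in auto)
  finally show ?thesis using f by simp
qed

text \<open>
  As \<open>f\<close> has total sum 0, \<open>(sum f S)\<^sup>2 = - sum f S * sum f (A - S)\<close> is minus the sum of \<open>f a * f b\<close>
  over the ordered pairs that \<open>S\<close> separates. Every pair of distinct elements is separated by the same
  number of sets \<open>S\<close>, and the sum of \<open>f a * f b\<close> over all such pairs is \<open>- (\<Sum>a\<in>A. (f a)\<^sup>2)\<close>.
\<close>

lemma sum_subset_sums_squared: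
  fixes f :: "'b \<Rightarrow> real"
  assumes A: "finite A" and f: "sum f A = 0" and i: "i \<ge> 1"
  shows "(\<Sum>S | S \<subseteq> A \<and> card S = i. (sum f S)\<^sup>2)
         = real ((card A - 2) choose (i - 1)) * (\<Sum>a\<in>A. (f a)\<^sup>2)"
proof -
  let ?\<S> = "{S. S \<subseteq> A \<and> card S = i}"
  let ?N = "real ((card A - 2) choose (i - 1))"
  have fin: "finite ?\<S>" by (rule finite_subset[of _ "Pow A"]) (use A in auto)
  define P where "P = {(a, b) \<in> A \<times> A. a \<noteq> b}"
  have finP: "finite P" by (rule finite_subset[of _ "A \<times> A"]) (use A in \<open>auto simp: P_def\<close>)
  have "(sum f S)\<^sup>2 = - (\<Sum>p | p \<in> P \<and> (fst p \<in> S \<and> snd p \<notin> S). f (fst p) * f (snd p))"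
    if S: "S \<in> ?\<S>" for S
  proof -
    have "sum f S + sum f (A - S) = 0"
      using sum.subset_diff[of S A f] A f S by simp
    hence "(sum f S)\<^sup>2 = - (sum f S * sum f (A - S))"
      by (simp add: power2_eq_square add_eq_0_iff)
    also have "sum f S * sum f (A - S) = (\<Sum>p\<in>S \<times> (A - S). f (fst p) * f (snd p))"
      by (simp add: sum_product sum.cartesian_product case_prod_unfold)
    also have "S \<times> (A - S) = {p. p \<in> P \<and> (fst p \<in> S \<and> snd p \<notin> S)}"
      using S unfolding P_def by auto
    finally show ?thesis .
  qed
  hence "(\<Sum>S\<in>?\<S>. (sum f S)\<^sup>2)
      = - (\<Sum>S\<in>?\<S>. \<Sum>p | p \<in> P \<and> (fst p \<in> S \<and> snd p \<notin> S). f (fst p) * f (snd p))"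
    by (simp add: sum_negf)
  also have "(\<Sum>S\<in>?\<S>. \<Sum>p | p \<in> P \<and> (fst p \<in> S \<and> snd p \<notin> S). f (fst p) * f (snd p))
     = (\<Sum>p\<in>P. \<Sum>S | S \<in> ?\<S> \<and> (fst p \<in> S \<and> snd p \<notin> S). f (fst p) * f (snd p))"
    by (rule sum.swap_restrict[OF fin finP])
  also have "\<dots> = (\<Sum>p\<in>P. ?N * (f (fst p) * f (snd p)))"
  proof (rule sum.cong)
    fix p assume p: "p \<in> P"
    have "card {S. S \<in> ?\<S> \<and> (fst p \<in> S \<and> snd p \<notin> S)} = (card A - 2) choose (i - 1)"
      using card_subsets_separating[OF A, of "fst p" "snd p" i] p i
      unfolding P_def by (auto simp: conj_assoc)
    thus "(\<Sum>S | S \<in> ?\<S> \<and> (fst p \<in> S \<and> snd p \<notin> S). f (fst p) * f (snd p))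
        = ?N * (f (fst p) * f (snd p))" by simp
  qed simp
  also have "\<dots> = ?N * (\<Sum>p\<in>P. f (fst p) * f (snd p))" by (simp add: sum_distrib_left)
  also have "(\<Sum>p\<in>P. f (fst p) * f (snd p)) = - (\<Sum>a\<in>A. (f a)\<^sup>2)"
  proof -
    have "0 = sum f A * sum f A" using f by simp
    also have "\<dots> = (\<Sum>p\<in>A \<times> A. f (fst p) * f (snd p))"
      by (simp add: sum_product sum.cartesian_product case_prod_unfold)
    also have "A \<times> A = P \<union> (\<lambda>a. (a, a)) ` A" unfolding P_def by auto
    also have "(\<Sum>p\<in>P \<union> (\<lambda>a. (a, a)) ` A. f (fst p) * f (snd p))
       = (\<Sum>p\<in>P. f (fst p) * f (snd p)) + (\<Sum>p\<in>(\<lambda>a. (a, a)) ` A. f (fst p) * f (snd p))"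
      using finP A by (intro sum.union_disjoint) (auto simp: P_def)
    also have "(\<Sum>p\<in>(\<lambda>a. (a, a)) ` A. f (fst p) * f (snd p)) = (\<Sum>a\<in>A. (f a)\<^sup>2)"
      by (subst sum.reindex) (auto simp: inj_on_def power2_eq_square)
    finally show ?thesis by simp
  qed
  finally show ?thesis by simp
qed

lemma binomial_second_difference:
  assumes "1 \<le> i" "i \<le> d" "d \<ge> 2"
  shows "real d * real (d - 1) * real ((d - 2) choose (i - 1)) = real (d choose i) * real i * real (d - i)"
proof -
  have 1: "i * (d choose i) = d * ((d - 1) choose (i - 1))"
    using assms by (intro times_binomial_minus1_eq) auto
  have 2: "(d - i) * ((d - 1) choose (i - 1)) = (d - 1) * ((d - 2) choose (i - 1))"
    using binomial_absorb_comp[of "d - 1" "i - 1"] assms by (simp add: numeral_2_eq_2)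
  have "real d * real (d - 1) * real ((d - 2) choose (i - 1)) = real (d * ((d - 1) * ((d - 2) choose (i - 1))))"
    by simp
  also have "\<dots> = real ((d - i) * (i * (d choose i)))"
    unfolding 2[symmetric] 1 by (simp add: mult_ac)
  finally show ?thesis by (simp add: mult_ac)
qed

text \<open>
  The normalised coefficient of index \<open>i\<close> of the rescaled \<open>p\<close> is \<open>1 + y m / m\<close>: the terms linear in
  \<open>\<theta>\<close> cancel because the \<open>\<theta> k\<close> sum to 0, and \<open>y m\<close> tends to half the average of the squared subset
  sums, \<open>\<sigma>\<^sup>2 * i * (d - i) / (2 * (d - 1))\<close>. Its \<open>m\<close>-th power tends to the exponential of this number.
\<close>

lemma finite_free_central_limit:
  assumes d: "d \<ge> 2" and p: "p = (\<Prod>k=1..d. [:- exp (\<theta> k), 1:])"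
    and th1: "(\<Sum>k=1..d. \<theta> k) = 0" and th2: "(\<Sum>k=1..d. (\<theta> k)\<^sup>2) = real d * \<sigma>\<^sup>2"
  shows "(\<lambda>m. coeff (ffmc_power d (root_power (1 / sqrt (real m)) p) m) j)
           \<longlonglongrightarrow> coeff (I_poly d (real d * \<sigma>\<^sup>2 / (real d - 1))) j"
proof (cases "j \<le> d")
  case False
  thus ?thesis by (simp add: coeff_ffmc_power coeff_I_poly)
next
  case True
  define i where "i = d - j"
  have i: "i \<le> d" "j = d - i" using True by (auto simp: i_def)
  let ?\<S> = "{S. S \<subseteq> {1..d} \<and> card S = i}"
  have cardS: "card ?\<S> = d choose i" using n_subsets[of "{1..d}" i] by simp
  define C where "C = real (d choose i)"
  have C: "C > 0" unfolding C_def using i by simp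
  define R where "R m = (\<Sum>S\<in>?\<S>. exp (sum \<theta> S / sqrt (real m)) - 1 - sum \<theta> S / sqrt (real m))" for m
  define y where "y m = real m * R m / C" for m
  have at: "atilde d (root_power (1 / sqrt (real m)) p) i = 1 + y m / real m" if "m > 0" for m
  proof -
    let ?s = "1 / sqrt (real m)"
    have "atilde d (root_power ?s p) i = (\<Sum>S\<in>?\<S>. \<Prod>k\<in>S. exp (?s * \<theta> k)) / C"
      unfolding p C_def using root_power_prod_exp[of "{1..d}" ?s \<theta>] atilde_prod_linear[OF i(1)] by simp
    also have "(\<Sum>S\<in>?\<S>. \<Prod>k\<in>S. exp (?s * \<theta> k)) = (\<Sum>S\<in>?\<S>. exp (sum \<theta> S / sqrt (real m)))"
      by (intro sum.cong refl, subst exp_sum[symmetric])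
         (auto dest: rev_finite_subset[OF finite_atLeastAtMost] simp: sum_divide_distrib)
    also have "\<dots> = (\<Sum>S\<in>?\<S>. 1 + sum \<theta> S / sqrt (real m)
           + (exp (sum \<theta> S / sqrt (real m)) - 1 - sum \<theta> S / sqrt (real m)))"
      by simp
    also have "\<dots> = (\<Sum>S\<in>?\<S>. 1 + sum \<theta> S / sqrt (real m))
           + (\<Sum>S\<in>?\<S>. exp (sum \<theta> S / sqrt (real m)) - 1 - sum \<theta> S / sqrt (real m))"
      by (rule sum.distrib)
    also have "(\<Sum>S\<in>?\<S>. 1 + sum \<theta> S / sqrt (real m)) = C"
      using sum_subset_sums_eq_0[of "{1..d}" \<theta> i] th1
      by (simp add: sum.distrib cardS[simplified] C_def flip: sum_divide_distrib)
    also have "(C + (\<Sum>S\<in>?\<S>. exp (sum \<theta> S / sqrt (real m)) - 1 - sum \<theta> S / sqrt (real m))) / C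
       = 1 + y m / real m"
      unfolding y_def R_def[symmetric] using C that by (simp add: field_simps)
    finally show ?thesis .
  qed
  have "y \<longlonglongrightarrow> (\<Sum>S\<in>?\<S>. (sum \<theta> S)\<^sup>2 / 2) / C"
    unfolding y_def R_def sum_distrib_left using C by (intro tendsto_intros exp_second_order_limit) auto
  also have "(\<Sum>S\<in>?\<S>. (sum \<theta> S)\<^sup>2 / 2) / C
        = real i * real (d - i) / (2 * real d) * (real d * \<sigma>\<^sup>2 / (real d - 1))"
  proof (cases "i = 0")
    case True
    have "?\<S> = {{}}" using True by (auto dest: rev_finite_subset[OF finite_atLeastAtMost])
    thus ?thesis using True by simp
  next
    case False
    have "(\<Sum>S\<in>?\<S>. (sum \<theta> S)\<^sup>2) = real ((d - 2) choose (i - 1)) * (real d * \<sigma>\<^sup>2)"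
      using sum_subset_sums_squared[of "{1..d}" \<theta> i] th1 th2 False by simp
    moreover have "real ((d - 2) choose (i - 1)) = C * real i * real (d - i) / (real d * (real d - 1))"
      using binomial_second_difference[of i d] False i d unfolding C_def
      by (simp add: field_simps of_nat_diff)
    ultimately have "(\<Sum>S\<in>?\<S>. (sum \<theta> S)\<^sup>2) = C * real i * real (d - i) / (real d * (real d - 1)) * (real d * \<sigma>\<^sup>2)"
      by (simp only:)
    thus ?thesis unfolding sum_divide_distrib[symmetric] using C d by simp
  qed
  finally have lim: "(\<lambda>m. (1 + y m / real m) ^ m)
      \<longlonglongrightarrow> exp (real i * real (d - i) / (2 * real d) * (real d * \<sigma>\<^sup>2 / (real d - 1)))"
    by (rule tendsto_power_one_plus_divide)
  have "(\<lambda>m. atilde d (root_power (1 / sqrt (real m)) p) i ^ m)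
      \<longlonglongrightarrow> exp (real i * real (d - i) / (2 * real d) * (real d * \<sigma>\<^sup>2 / (real d - 1)))"
    by (rule Lim_transform_eventually[OF lim])
       (use eventually_gt_at_top[of 0] in \<open>eventually_elim, simp add: at\<close>)
  hence "(\<lambda>m. (-1) ^ i * real (d choose i) * atilde d (root_power (1 / sqrt (real m)) p) i ^ m)
      \<longlonglongrightarrow> (-1) ^ i * real (d choose i) * exp (real i * real (d - i) / (2 * real d) * (real d * \<sigma>\<^sup>2 / (real d - 1)))"
    by (intro tendsto_intros)
  thus ?thesis using True by (simp add: coeff_ffmc_power coeff_I_poly i_def)
qed

section \<open>Positive roots\<close>

text \<open>
  The leading coefficient is left free because the differential operators applied below do not
  preserve monic polynomials.
\<close>

definition pos_rooted :: "nat \<Rightarrow> complex poly \<Rightarrow> bool" where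
  "pos_rooted d P \<longleftrightarrow> (\<exists>c (r::nat \<Rightarrow> real). c \<noteq> 0 \<and> (\<forall>k. r k > 0) \<and>
     P = smult c (\<Prod>k=1..d. [:- of_real (r k), 1:]))"

lemma degree_prod_linear [simp]:
  "degree (\<Prod>k\<in>A. [:- a k, 1:] :: 'a::idom poly) = card A"
  by (subst degree_prod_eq_sum_degree) auto

lemma lead_coeff_prod_linear:
  "lead_coeff (\<Prod>k\<in>A. [:- a k, 1:] :: 'a::idom poly) = 1"
  by (subst lead_coeff_prod) simp

lemma pos_rootedI:
  assumes "degree P = d" "P \<noteq> 0"
    and "\<And>z. poly P z = 0 \<Longrightarrow> \<exists>x>0. z = of_real x"
  shows "pos_rooted d P"
  using assms
proof (induction d arbitrary: P)
  case 0
  then obtain a where "P = [:a:]" by (auto elim: degree_eq_zeroE)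
  with 0 have "a \<noteq> 0 \<and> (\<forall>k::nat. (1::real) > 0) \<and> P = smult a (\<Prod>k=1..0::nat. [:- of_real 1, 1:])"
    by simp
  thus ?case unfolding pos_rooted_def by (intro exI[of _ a] exI[of _ "\<lambda>_. 1"])
next
  case (Suc d)
  obtain z where z: "poly P z = 0"
    using alg_closed_imp_poly_has_root[of P] Suc.prems by auto
  with Suc.prems obtain x where x: "x > 0" "z = of_real x" by blast
  obtain Q where Q: "P = [:- of_real x, 1:] * Q"
    using z x by (auto simp: poly_eq_0_iff_dvd elim: dvdE)
  have "Q \<noteq> 0" using Q Suc.prems by auto
  moreover have "degree Q = d"
    using Suc.prems(1) \<open>Q \<noteq> 0\<close> unfolding Q by (subst (asm) degree_mult_eq) auto
  ultimately have "pos_rooted d Q" using Suc.prems(3) Q by (intro Suc.IH) auto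
  then obtain c r where cr: "c \<noteq> 0" "\<forall>k. r k > 0" "Q = smult c (\<Prod>k=1..d. [:- of_real (r k), 1:])"
    unfolding pos_rooted_def by blast
  define r' where "r' = r(Suc d := x)"
  have "(\<Prod>k=1..d. [:- complex_of_real (r k), 1:]) = (\<Prod>k=1..d. [:- of_real (r' k), 1:])"
    by (rule prod.cong) (auto simp: r'_def)
  hence "P = smult c (\<Prod>k=1..Suc d. [:- of_real (r' k), 1:])"
    unfolding Q cr(3) by (simp add: r'_def mult.commute)
  moreover have "\<forall>k. r' k > 0" using cr x by (simp add: r'_def)
  ultimately show ?case unfolding pos_rooted_def using cr(1) by blast
qed

lemma pos_rootedD:
  assumes "pos_rooted d P"
  shows "degree P = d" "P \<noteq> 0" "poly P z = 0 \<Longrightarrow> \<exists>x>0. z = of_real x"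
proof -
  obtain c r where cr: "c \<noteq> 0" "\<forall>k. r k > 0" "P = smult c (\<Prod>k=1..d. [:- of_real (r k), 1:])"
    using assms unfolding pos_rooted_def by blast
  show "degree P = d" using cr by simp
  show "P \<noteq> 0" using cr by auto
  show "\<exists>x>0. z = of_real x" if "poly P z = 0"
    using that cr by (auto simp: poly_prod)
qed

text \<open>
  Each linear factor contributes at least \<open>\<delta>\<close>. Apart from \<open>\<delta>\<close> and \<open>d\<close> the bound involves only the
  leading coefficient, not the position of the roots, so it passes to coefficientwise limits.
\<close>

lemma norm_pos_rooted_ge:
  assumes "pos_rooted d P" and \<delta>: "\<delta> \<ge> 0" "\<And>x. x > 0 \<Longrightarrow> norm (z - of_real x) \<ge> \<delta>"
  shows "norm (poly P z) \<ge> norm (coeff P d) * \<delta> ^ d"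
proof -
  obtain c r where cr: "c \<noteq> 0" "\<forall>k. r k > 0" "P = smult c (\<Prod>k=1..d. [:- of_real (r k), 1:])"
    using assms unfolding pos_rooted_def by blast
  have "coeff P d = c"
    using lead_coeff_prod_linear[of "\<lambda>k. complex_of_real (r k)" "{1..d}"] cr by simp
  moreover have "norm (poly P z) = norm c * (\<Prod>k=1..d. norm (z - of_real (r k)))"
    unfolding cr(3) by (simp add: poly_prod norm_mult prod_norm)
  moreover have "(\<Prod>k=1..d. norm (z - of_real (r k))) \<ge> (\<Prod>k=1..d. \<delta>)"
    using \<delta> cr by (intro prod_mono) auto
  ultimately show ?thesis by (simp add: mult_left_mono)
qed

text \<open>
  A Hurwitz-type closure property: at a point at distance at least
  \<open>\<delta> > 0\<close> from the positive axis, the lower bound \<open>norm_pos_rooted_ge\<close> survives the limit. The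
  condition on \<open>coeff Q 0\<close> stops a root from moving to 0.
\<close>

lemma pos_rooted_limit:
  assumes P: "\<And>n. pos_rooted d (P n)" and lim: "\<And>j. (\<lambda>n. coeff (P n) j) \<longlonglongrightarrow> coeff Q j"
    and Q: "degree Q = d" "coeff Q 0 \<noteq> 0"
  shows "pos_rooted d Q"
proof (rule pos_rootedI)
  show "Q \<noteq> 0" using Q by auto
  fix z assume z: "poly Q z = 0"
  show "\<exists>x>0. z = complex_of_real x"
  proof (rule ccontr)
    assume contr: "\<not> ?thesis"
    have "z \<noteq> 0" using z Q(2) by (auto simp: poly_0_coeff_0)
    \<comment> \<open>\<open>\<delta>\<close> is at most the distance from \<open>z\<close> to the positive axis.\<close>
    define \<delta> where "\<delta> = (if Im z \<noteq> 0 then \<bar>Im z\<bar> else - Re z)"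
    have "Im z = 0 \<Longrightarrow> Re z < 0"
      using contr \<open>z \<noteq> 0\<close> by (metis complex_eq_iff complex_of_real_def complex.sel linorder_less_linear zero_complex.sel)
    hence \<delta>: "\<delta> > 0" by (auto simp: \<delta>_def)
    have \<delta>': "norm (z - of_real x) \<ge> \<delta>" if "x > 0" for x
      using abs_Im_le_cmod[of "z - of_real x"] abs_Re_le_cmod[of "z - of_real x"] that
      by (auto simp: \<delta>_def)
    have "(\<lambda>n. norm (coeff (P n) d) * \<delta> ^ d) \<longlonglongrightarrow> norm (coeff Q d) * \<delta> ^ d"
      by (intro tendsto_intros lim)
    moreover have "(\<lambda>n. norm (poly (P n) z)) \<longlonglongrightarrow> norm (poly Q z)"
      unfolding poly_altdef Q(1) pos_rootedD(1)[OF P] by (intro tendsto_intros lim)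
    ultimately have "norm (coeff Q d) * \<delta> ^ d \<le> norm (poly Q z)"
      using norm_pos_rooted_ge[OF P less_imp_le[OF \<delta>] \<delta>'] by (intro LIMSEQ_le) auto
    moreover have "coeff Q d \<noteq> 0"
      using Q by (metis coeff_0 leading_coeff_0_iff)
    hence "norm (coeff Q d) * \<delta> ^ d > 0" using \<delta> by simp
    ultimately show False using z by simp
  qed
qed (use Q in auto)

text \<open>
  The differential operator \<open>1 + s x D\<close>, which multiplies the coefficient of \<open>x ^ j\<close> by \<open>1 + s j\<close>.
\<close>

definition euler_shift :: "real \<Rightarrow> complex poly \<Rightarrow> complex poly" where
  "euler_shift s P = P + smult (of_real s) ([:0, 1:] * pderiv P)"

lemma coeff_euler_shift: "coeff (euler_shift s P) j = of_real (1 + s * real j) * coeff P j"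
  by (cases j) (auto simp: euler_shift_def coeff_pderiv coeff_pCons algebra_simps)

text \<open>
  At a point \<open>z\<close> that is not a root of \<open>P\<close>, dividing by \<open>P z\<close> leaves \<open>1 + s (\<Sum>k. z / (z - r k))\<close>. The
  imaginary parts of the summands all have the sign opposite to that of \<open>Im z\<close>, so a zero must be
  real. For real \<open>z \<le> 0\<close> every summand lies in \<open>[0, 1]\<close>, so the expression is at least
  \<open>min 1 (1 + s d) > 0\<close>, and a zero must be positive.
\<close>

lemma pos_rooted_euler_shift:
  assumes P: "pos_rooted d P" and s: "1 + s * real d > 0"
  shows "pos_rooted d (euler_shift s P)"
proof (rule pos_rootedI)
  obtain c r where cr: "c \<noteq> 0" "\<forall>k. r k > 0" "P = smult c (\<Prod>k=1..d. [:- of_real (r k), 1:])"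
    using P unfolding pos_rooted_def by blast
  have cd: "coeff (euler_shift s P) d \<noteq> 0"
    using s pos_rootedD[OF P] leading_coeff_0_iff[of P] unfolding coeff_euler_shift
    by (auto simp del: of_real_add of_real_mult)
  show "degree (euler_shift s P) = d"
    using pos_rootedD(1)[OF P] cd
    by (intro antisym degree_le le_degree) (auto simp: coeff_euler_shift coeff_eq_0)
  show "euler_shift s P \<noteq> 0" using cd by auto
  fix z assume z: "poly (euler_shift s P) z = 0"
  show "\<exists>x>0. z = complex_of_real x"
  proof (rule ccontr)
    assume contr: "\<not> ?thesis"
    hence Pz: "poly P z \<noteq> 0" using pos_rootedD(3)[OF P] by blast
    have nz: "z - of_real (r k) \<noteq> 0" for k using contr cr(2) by auto
    have "poly (pderiv P) z = poly P z * (\<Sum>k=1..d. 1 / (z - of_real (r k)))"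
    proof -
      have "poly (pderiv P) z = c * (\<Sum>k=1..d. \<Prod>l\<in>{1..d}-{k}. z - of_real (r l))"
        unfolding cr(3) by (simp add: pderiv_smult pderiv_prod poly_sum poly_prod pderiv_pCons)
      also have "(\<Sum>k=1..d. \<Prod>l\<in>{1..d}-{k}. z - of_real (r l))
         = (\<Sum>k=1..d. (\<Prod>l=1..d. z - of_real (r l)) * (1 / (z - of_real (r k))))"
      proof (rule sum.cong)
        fix k assume "k \<in> {1..d}"
        thus "(\<Prod>l\<in>{1..d}-{k}. z - of_real (r l)) = (\<Prod>l=1..d. z - of_real (r l)) * (1 / (z - of_real (r k)))"
          using nz[of k] by (subst (2) prod.remove[of _ k]) auto
      qed simp
      finally show ?thesis unfolding cr(3) by (simp add: poly_prod sum_distrib_left mult.assoc)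
    qed
    hence "poly P z * (1 + of_real s * (\<Sum>k=1..d. z / (z - of_real (r k)))) = 0"
      using z by (simp add: euler_shift_def algebra_simps sum_distrib_left)
    hence eq: "1 + of_real s * (\<Sum>k=1..d. z / (z - of_real (r k))) = 0" using Pz by simp
    have im: "Im (z / (z - of_real (r k))) = - Im z * (r k / (norm (z - of_real (r k)))\<^sup>2)" for k
      by (simp add: Im_divide cmod_power2 algebra_simps)
    have sd: "s \<noteq> 0" "d \<ge> 1"
      using eq by (auto intro!: Suc_leI gr0I)
    have "s * (- Im z * (\<Sum>k=1..d. r k / (norm (z - of_real (r k)))\<^sup>2)) = 0"
    proof -
      define S where "S = (\<Sum>k=1..d. z / (z - of_real (r k)))"
      have "s * Im S = 0" using arg_cong[OF eq, of Im] unfolding S_def[symmetric] by simp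
      thus ?thesis unfolding S_def Im_sum im by (simp add: sum_distrib_left sum_negf)
    qed
    hence "Im z * (\<Sum>k=1..d. r k / (norm (z - of_real (r k)))\<^sup>2) = 0"
      using sd by simp
    moreover have "(\<Sum>k=1..d. r k / (norm (z - of_real (r k)))\<^sup>2) > 0"
      using cr nz sd by (intro sum_pos) auto
    ultimately have "Im z = 0" by simp
    then obtain x where zx: "z = of_real x"
      by (metis complex_is_Real_iff Reals_cases)
    with contr have x: "x \<le> 0" by force
    have u: "0 \<le> x / (x - r k) \<and> x / (x - r k) \<le> 1" for k
      using x cr(2)[rule_format, of k] by (auto simp: divide_simps)
    have "complex_of_real (1 + s * (\<Sum>k=1..d. x / (x - r k))) = 0"
      using eq unfolding zx by (simp flip: of_real_diff of_real_divide of_real_sum)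
    hence e0: "1 + s * (\<Sum>k=1..d. x / (x - r k)) = 0" by (simp only: of_real_eq_0_iff)
    have U0: "(\<Sum>k=1..d. x / (x - r k)) \<ge> 0" using u by (intro sum_nonneg) auto
    have "(\<Sum>k=1..d. x / (x - r k)) \<le> (\<Sum>k=1..d. 1)" using u by (intro sum_mono) auto
    hence U1: "(\<Sum>k=1..d. x / (x - r k)) \<le> real d" by simp
    show False
    proof (cases "s \<ge> 0")
      case True
      thus False using e0 U0 mult_nonneg_nonneg[of s "\<Sum>k=1..d. x / (x - r k)"] by linarith
    next
      case False
      hence "s * (\<Sum>k=1..d. x / (x - r k)) \<ge> s * real d"
        using U1 by (intro mult_left_mono_neg) auto
      thus False using e0 s by linarith
    qed
  qed
qed

text \<open>
  The Gaussian multiplier is a limit of products of linear ones: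
  \<open>(1 - c j\<^sup>2 / n) ^ n = ((1 - s j) (1 + s j)) ^ n\<close> with \<open>s = sqrt (c / n)\<close>, and both linear multipliers
  preserve positive roots as soon as \<open>s d < 1\<close>.
\<close>

lemma pos_rooted_gaussian_multiplier:
  assumes P: "pos_rooted d P" and c: "c \<ge> 0"
    and Q: "\<And>j. coeff Q j = of_real (exp (- c * (real j)\<^sup>2)) * coeff P j"
  shows "pos_rooted d Q"
proof -
  define s where "s n = sqrt (c / real n)" for n
  define T where "T n = ((euler_shift (s n) \<circ> euler_shift (- s n)) ^^ n) P" for n
  have coeffT: "coeff (((euler_shift a \<circ> euler_shift (- a)) ^^ n) P) j
      = of_real ((1 - a\<^sup>2 * (real j)\<^sup>2) ^ n) * coeff P j" for a n j
    by (induction n) (auto simp: coeff_euler_shift algebra_simps power2_eq_square)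
  have pos: "pos_rooted d (((euler_shift a \<circ> euler_shift (- a)) ^^ n) P)"
    if "0 \<le> a" "a * real d < 1" for a n
    using that P by (induction n) (auto intro!: pos_rooted_euler_shift simp: add_pos_nonneg)
  have lim: "(\<lambda>n. coeff (T n) j) \<longlonglongrightarrow> coeff Q j" for j
  proof -
    have "(\<lambda>n. (1 + (- c * (real j)\<^sup>2) / real n) ^ n) \<longlonglongrightarrow> exp (- c * (real j)\<^sup>2)"
      by (rule tendsto_exp_limit_sequentially)
    hence "(\<lambda>n. complex_of_real ((1 + (- c * (real j)\<^sup>2) / real n) ^ n) * coeff P j) \<longlonglongrightarrow> coeff Q j"
      unfolding Q by (intro tendsto_intros)
    thus ?thesis unfolding T_def coeffT s_def using c by simp
  qed
  have s0: "s \<longlonglongrightarrow> 0"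
  proof -
    have "(\<lambda>n. sqrt (c * inverse (real n))) \<longlonglongrightarrow> sqrt (c * 0)"
      by (intro tendsto_intros lim_inverse_n)
    thus ?thesis by (simp add: s_def[abs_def] divide_inverse)
  qed
  have "(\<lambda>n. s n * real d) \<longlonglongrightarrow> 0 * real d"
    by (intro tendsto_intros s0)
  hence "\<forall>\<^sub>F n in sequentially. s n * real d < 1"
    by (intro order_tendstoD(2)) auto
  then obtain N where N: "\<And>n. n \<ge> N \<Longrightarrow> s n * real d < 1"
    unfolding eventually_sequentially by blast
  \<comment> \<open>Both operators preserve positive roots only once \<open>s n * d < 1\<close>, hence the shift by \<open>N\<close>.\<close>
  show ?thesis
  proof (rule pos_rooted_limit[where P = "\<lambda>n. T (n + N)"])
    show "pos_rooted d (T (n + N))" for n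
      unfolding T_def by (rule pos) (use c N[of "n + N"] in \<open>auto simp: s_def\<close>)
    show "(\<lambda>n. coeff (T (n + N)) j) \<longlonglongrightarrow> coeff Q j" for j
      using lim[of j] by (rule LIMSEQ_ignore_initial_segment)
    have "coeff P d \<noteq> 0" using pos_rootedD(1,2)[OF P] by auto
    thus "degree Q = d"
      using pos_rootedD(1)[OF P] by (intro antisym degree_le le_degree) (auto simp: Q coeff_eq_0)
    have "poly P 0 \<noteq> 0" using pos_rootedD(3)[OF P, of 0] by auto
    thus "coeff Q 0 \<noteq> 0" by (simp add: Q poly_0_coeff_0)
  qed
qed

text \<open>
  The coefficient of \<open>x ^ j\<close> carries the factor
  \<open>exp (j (d - j) t / (2 d)) = exp (t / 2) ^ j * exp (- j\<^sup>2 t / (2 d))\<close>. So \<open>I_poly d t\<close> arises from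
  \<open>(E x - 1) ^ d\<close> with \<open>E = exp (t / 2)\<close> by a Gaussian multiplier.
\<close>

lemma I_poly_splits:
  assumes d: "d \<ge> 1" and t: "t \<ge> 0"
  shows "\<exists>r. (\<forall>k. r k > 0) \<and> I_poly d t = (\<Prod>k=1..d. [:- r k, 1:])"
proof -
  define E where "E = exp (t / 2)"
  have E: "E > 0" by (simp add: E_def)
  define P where "P = [:-1, complex_of_real E:] ^ d"
  have P_eq: "P = smult (of_real E ^ d) (\<Prod>k=1..d. [:- of_real (1 / E), 1:])"
    unfolding P_def using E
    by (simp add: smult_power[symmetric] flip: of_real_mult)
  have P: "pos_rooted d P"
    unfolding pos_rooted_def P_eq using E
    by (intro exI[of _ "of_real E ^ d"] exI[of _ "\<lambda>_. 1 / E"]) auto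
  have coeffP: "coeff P j = of_real (if j \<le> d then (-1) ^ (d - j) * real (d choose (d - j)) * E ^ j else 0)" for j
  proof (cases "j \<le> d")
    case True
    have "coeff (\<Prod>k=1..d. [:- complex_of_real (1 / E), 1:]) (d - (d - j))
       = (-1) ^ (d - j) * of_nat (d choose (d - j)) * (of_real (1 / E)) ^ (d - j)"
      using coeff_prod_linear[of "{1..d}" "d - j" "\<lambda>_. complex_of_real (1 / E)"] n_subsets[of "{1..d}" "d - j"]
      by simp
    moreover have "E ^ d * (1 / E) ^ (d - j) = E ^ j"
      using E True by (simp add: power_diff field_simps)
    hence "complex_of_real E ^ d * (of_real (1 / E)) ^ (d - j) = of_real E ^ j"
      by (metis of_real_mult of_real_power)
    ultimately show ?thesis
      unfolding P_eq using True by (simp add: mult_ac)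
  next
    case False
    thus ?thesis using pos_rootedD(1)[OF P] by (simp add: coeff_eq_0)
  qed
  define Q where "Q = map_poly complex_of_real (I_poly d t)"
  have "pos_rooted d Q"
  proof (rule pos_rooted_gaussian_multiplier[OF P, of "t / (2 * real d)"])
    fix j
    show "coeff Q j = of_real (exp (- (t / (2 * real d)) * (real j)\<^sup>2)) * coeff P j"
    proof (cases "j \<le> d")
      case True
      have "exp (real (d - j) * real j / (2 * real d) * t) = exp (- (t / (2 * real d)) * (real j)\<^sup>2) * E ^ j"
        unfolding E_def exp_of_nat_mult[symmetric] exp_add[symmetric] using True d
        by (simp add: field_simps power2_eq_square of_nat_diff)
      thus ?thesis using True unfolding Q_def coeffP
        by (simp add: coeff_map_poly coeff_I_poly mult_ac)
    qed (simp add: Q_def coeff_map_poly coeff_I_poly coeffP)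
  qed (use t d in auto)
  then obtain c r where cr: "c \<noteq> 0" "\<forall>k. r k > 0" "Q = smult c (\<Prod>k=1..d. [:- of_real (r k), 1:])"
    unfolding pos_rooted_def by blast
  have "coeff Q d = c"
    using lead_coeff_prod_linear[of "\<lambda>k. complex_of_real (r k)" "{1..d}"] cr by simp
  hence c1: "c = 1" by (simp add: Q_def coeff_map_poly coeff_I_poly)
  have "I_poly d t = (\<Prod>k=1..d. [:- r k, 1:])"
  proof (rule poly_eqI)
    fix j
    show "coeff (I_poly d t) j = coeff (\<Prod>k=1..d. [:- r k, 1:]) j"
    proof (cases "j \<le> d")
      case True
      have "complex_of_real (coeff (\<Prod>k=1..d. [:- r k, 1:]) (d - (d - j)))
        = coeff (\<Prod>k=1..d. [:- complex_of_real (r k), 1:]) (d - (d - j))"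
        using coeff_prod_linear[of "{1..d}" "d - j" r]
          coeff_prod_linear[of "{1..d}" "d - j" "\<lambda>k. complex_of_real (r k)"] by simp
      also have "\<dots> = complex_of_real (coeff (I_poly d t) (d - (d - j)))"
        using cr(3) c1 by (simp add: Q_def coeff_map_poly[symmetric])
      finally show ?thesis using True by simp
    qed (simp add: coeff_I_poly coeff_eq_0)
  qed
  thus ?thesis using cr(2) by blast
qed

section \<open>Power series depending on a parameter and the moments of the roots\<close>

text \<open>
  Derivatives in the parameter are taken coefficientwise. This is enough for the product rule, because
  each coefficient of a product is a finite sum.
\<close>

definition fps_has_deriv :: "(real \<Rightarrow> real fps) \<Rightarrow> real fps \<Rightarrow> real \<Rightarrow> bool" where
  "fps_has_deriv F F' t \<longleftrightarrow>
     (\<forall>n. ((\<lambda>s. fps_nth (F s) n) has_real_derivative fps_nth F' n) (at t))"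

lemma fps_has_deriv_mult:
  assumes "fps_has_deriv F F' t" "fps_has_deriv G G' t"
  shows "fps_has_deriv (\<lambda>s. F s * G s) (F' * G t + F t * G') t"
  unfolding fps_has_deriv_def fps_mult_nth fps_add_nth sum.distrib[symmetric]
proof
  fix n
  show "((\<lambda>s. \<Sum>i=0..n. fps_nth (F s) i * fps_nth (G s) (n - i)) has_real_derivative
      (\<Sum>i=0..n. fps_nth F' i * fps_nth (G t) (n - i) + fps_nth (F t) i * fps_nth G' (n - i))) (at t)"
    by (intro DERIV_sum DERIV_cong[OF DERIV_mult[OF
          assms(1)[unfolded fps_has_deriv_def, rule_format] assms(2)[unfolded fps_has_deriv_def, rule_format]]])
       (simp add: algebra_simps)
qed

lemma fps_has_deriv_const: "fps_has_deriv (\<lambda>s. c) 0 t"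
  by (simp add: fps_has_deriv_def)

lemma fps_has_deriv_power:
  assumes "fps_has_deriv F F' t"
  shows "fps_has_deriv (\<lambda>s. F s ^ n) (of_nat n * F t ^ (n - 1) * F') t"
proof (induction n)
  case 0
  show ?case using fps_has_deriv_const[of 1 t] by simp
next
  case (Suc n)
  have "F' * F t ^ n + F t * (of_nat n * F t ^ (n - 1) * F') = of_nat (Suc n) * F t ^ n * F'"
    by (cases n) (simp_all add: algebra_simps)
  thus ?case using fps_has_deriv_mult[OF assms Suc] by simp
qed

text \<open>
  The relation \<open>F * inverse F = 1\<close> with \<open>F\<close> having constant coefficient 1 expresses each coefficient
  of the inverse through earlier ones, so differentiability follows by induction.
\<close>

lemma fps_has_deriv_inverse:
  assumes F: "\<And>t. fps_has_deriv F (F' t) t" and F0: "\<And>t. fps_nth (F t) 0 = 1"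
  shows "fps_has_deriv (\<lambda>s. inverse (F s)) (- (F' t * (inverse (F t))\<^sup>2)) t"
proof -
  define D where "D t = - (F' t * (inverse (F t))\<^sup>2)" for t
  have inv: "F s * inverse (F s) = 1" for s
    using F0 by (simp add: inverse_mult_eq_1')
  have FD: "F t * D t = - (F' t * inverse (F t))"
  proof -
    have "F t * D t = - (F t * inverse (F t)) * (F' t * inverse (F t))"
      unfolding D_def by (simp add: power2_eq_square algebra_simps)
    thus ?thesis unfolding inv by simp
  qed
  have F'0: "fps_nth (F' t) 0 = 0" for t
  proof -
    have "((\<lambda>s. fps_nth (F s) 0) has_real_derivative fps_nth (F' t) 0) (at t)"
      using F[of t] unfolding fps_has_deriv_def by blast
    moreover have "((\<lambda>s. fps_nth (F s) 0) has_real_derivative 0) (at t)"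
      unfolding F0 by simp
    ultimately show ?thesis by (rule DERIV_unique)
  qed
  have rec: "fps_nth (inverse (F s)) n = fps_nth 1 n - (\<Sum>i=1..n. fps_nth (F s) i * fps_nth (inverse (F s)) (n - i))" for s n
    using arg_cong[OF inv[of s], of "\<lambda>f. fps_nth f n"] F0
    by (simp add: fps_mult_nth sum.atLeast_Suc_atMost)
  have "((\<lambda>s. fps_nth (inverse (F s)) n) has_real_derivative fps_nth (D t) n) (at t)" for n
  proof (induction n rule: less_induct)
    case (less n)
    have "((\<lambda>s. fps_nth 1 n - (\<Sum>i=1..n. fps_nth (F s) i * fps_nth (inverse (F s)) (n - i))) has_real_derivative
       (0 - (\<Sum>i=1..n. fps_nth (F' t) i * fps_nth (inverse (F t)) (n - i) + fps_nth (F t) i * fps_nth (D t) (n - i)))) (at t)"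
    proof (intro DERIV_diff DERIV_const DERIV_sum)
      fix i assume "i \<in> {1..n}"
      hence "n - i < n" by auto
      thus "((\<lambda>s. fps_nth (F s) i * fps_nth (inverse (F s)) (n - i)) has_real_derivative
          fps_nth (F' t) i * fps_nth (inverse (F t)) (n - i) + fps_nth (F t) i * fps_nth (D t) (n - i)) (at t)"
        using F[of t] unfolding fps_has_deriv_def
        by (intro DERIV_cong[OF DERIV_mult[OF _ less]]) (auto simp: algebra_simps)
    qed
    moreover have "0 - (\<Sum>i=1..n. fps_nth (F' t) i * fps_nth (inverse (F t)) (n - i) + fps_nth (F t) i * fps_nth (D t) (n - i))
        = fps_nth (D t) n"
    proof -
      have "fps_nth (F t * D t) n = - fps_nth (F' t * inverse (F t)) n" using FD by simp
      thus ?thesis using F0 F'0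
        by (simp add: fps_mult_nth sum.atLeast_Suc_atMost sum.distrib)
    qed
    ultimately show ?case unfolding rec[symmetric] by simp
  qed
  thus ?thesis unfolding fps_has_deriv_def D_def by blast
qed

text \<open>
  The Euler operator \<open>y d/dy\<close>, a derivation that multiplies the \<open>n\<close>-th coefficient by \<open>n\<close>.
\<close>

definition fps_theta :: "real fps \<Rightarrow> real fps" where "fps_theta f = fps_X * fps_deriv f"

lemma fps_theta_nth [simp]: "fps_nth (fps_theta f) n = real n * fps_nth f n"
  by (cases n) (simp_all add: fps_theta_def)

lemma fps_theta_mult: "fps_theta (f * g) = fps_theta f * g + f * fps_theta g"
  by (simp add: fps_theta_def algebra_simps)

lemma fps_theta_power: "fps_theta (f ^ n) = of_nat n * f ^ (n - 1) * fps_theta f"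
proof (induction n)
  case (Suc n)
  thus ?case by (cases n) (simp_all add: fps_theta_mult algebra_simps)
qed (simp add: fps_theta_def)

lemma fps_theta_prod:
  assumes "finite A" "\<And>k. k \<in> A \<Longrightarrow> fps_nth (f k) 0 \<noteq> 0"
  shows "fps_theta (\<Prod>k\<in>A. f k) = (\<Prod>k\<in>A. f k) * (\<Sum>k\<in>A. fps_theta (f k) * inverse (f k))"
  using assms
proof (induction A rule: finite_induct)
  case (insert a A)
  have "f a * inverse (f a) = 1" using insert by (simp add: inverse_mult_eq_1')
  hence "fps_theta (f a) * (\<Prod>k\<in>A. f k) = f a * inverse (f a) * fps_theta (f a) * (\<Prod>k\<in>A. f k)"
    by simp
  thus ?case using insert by (simp add: fps_theta_mult algebra_simps)
qed (simp add: fps_theta_def)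

text \<open>
  The reversed polynomial \<open>y ^ d * I_poly d t (1 / y)\<close>, which factors as \<open>\<Prod>k. 1 - r k * y\<close>. Writing
  \<open>real d - real k\<close> makes the exponent polynomial in \<open>k\<close>; the terms with \<open>k > d\<close> vanish through the
  binomial coefficient.
\<close>

definition I_fps :: "nat \<Rightarrow> real \<Rightarrow> real fps" where
  "I_fps d t = Abs_fps (\<lambda>k. (-1) ^ k * real (d choose k) * exp (real k * (real d - real k) / (2 * real d) * t))"

text \<open>
  Minus the logarithmic derivative of \<open>I_fps d t\<close>, divided by \<open>d\<close>: the generating series
  \<open>\<Sum>n\<ge>1. m\<^sub>n y ^ n\<close> of the moments of the root distribution (Newton's identities).
\<close>

definition root_moment_fps :: "nat \<Rightarrow> real \<Rightarrow> real fps" where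
  "root_moment_fps d t = - (fps_const (1 / real d) * fps_theta (I_fps d t) * inverse (I_fps d t))"

lemma I_fps_eq_prod:
  assumes "I_poly d t = (\<Prod>k=1..d. [:- r k, 1:])"
  shows "I_fps d t = (\<Prod>k=1..d. 1 - fps_const (r k) * fps_X)"
proof -
  have "I_fps d t = fps_of_poly (reflect_poly (I_poly d t))"
  proof (rule fps_ext)
    fix n
    have "degree (I_poly d t) = d" unfolding assms by simp
    thus "fps_nth (I_fps d t) n = fps_nth (fps_of_poly (reflect_poly (I_poly d t))) n"
      by (simp add: I_fps_def coeff_reflect_poly coeff_I_poly of_nat_diff)
  qed
  also have "\<dots> = (\<Prod>k=1..d. fps_of_poly (reflect_poly [:- r k, 1:]))"
    unfolding assms reflect_poly_prod fps_of_poly_prod ..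
  also have "\<dots> = (\<Prod>k=1..d. 1 - fps_const (r k) * fps_X)"
    by (intro prod.cong refl)
       (simp add: reflect_poly_def cCons_def fps_of_poly_pCons flip: fps_const_neg)
  finally show ?thesis .
qed

lemma fps_geometric_theta:
  "n \<ge> 1 \<Longrightarrow> fps_nth (fps_theta (1 - fps_const c * fps_X) * inverse (1 - fps_const c * fps_X)) n = - ((c::real) ^ n)"
proof -
  assume n: "n \<ge> 1"
  have inv: "inverse (1 - fps_const c * fps_X) = Abs_fps (\<lambda>n. c ^ n)"
    by (rule fps_inverse_unique, rule fps_ext)
       (auto simp: algebra_simps power_eq_if)
  have "fps_theta (1 - fps_const c * fps_X) = - (fps_const c * fps_X)"
    by (simp add: fps_theta_def)
  thus ?thesis using n unfolding inv
    by (cases n) (simp_all add: mult.assoc)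
qed

lemma root_moment_fps_nth:
  assumes "I_poly d t = (\<Prod>k=1..d. [:- r k, 1:])" "n \<ge> 1"
  shows "fps_nth (root_moment_fps d t) n = (1 / real d) * (\<Sum>k=1..d. r k ^ n)"
proof -
  let ?f = "\<lambda>k. 1 - fps_const (r k) * fps_X"
  have inv: "I_fps d t * inverse (I_fps d t) = 1"
    by (simp add: inverse_mult_eq_1' I_fps_def)
  have "fps_theta (I_fps d t) = I_fps d t * (\<Sum>k=1..d. fps_theta (?f k) * inverse (?f k))"
    unfolding I_fps_eq_prod[OF assms(1)] by (rule fps_theta_prod) auto
  hence "root_moment_fps d t = - (fps_const (1 / real d) * ((I_fps d t * inverse (I_fps d t)) * (\<Sum>k=1..d. fps_theta (?f k) * inverse (?f k))))"
    unfolding root_moment_fps_def by (simp add: mult_ac)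
  hence "root_moment_fps d t = - (fps_const (1 / real d) * (\<Sum>k=1..d. fps_theta (?f k) * inverse (?f k)))"
    unfolding inv by simp
  thus ?thesis using assms(2) by (simp add: fps_sum_nth fps_geometric_theta sum_negf)
qed

lemma root_moment_fps_0: "fps_nth (root_moment_fps d t) 0 = 0"
  by (simp add: root_moment_fps_def fps_mult_nth)

lemma root_moment_fps_at_0:
  assumes "d \<ge> 1" "n \<ge> 1"
  shows "fps_nth (root_moment_fps d 0) n = 1"
proof -
  have "I_poly d 0 = (\<Prod>k=1..d. [:- 1, 1:])"
  proof (rule poly_eqI)
    fix j
    show "coeff (I_poly d 0) j = coeff (\<Prod>k=1..d. [:- 1, 1:]) j"
    proof (cases "j \<le> d")
      case True
      thus ?thesis
        using coeff_prod_linear[of "{1..d}" "d - j" "\<lambda>_. 1::real"] n_subsets[of "{1..d}" "d - j"]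
        by (simp add: coeff_I_poly)
    next
      case False
      thus ?thesis using degree_prod_linear[of "\<lambda>_. 1::real" "{1..d}"]
        by (simp add: coeff_I_poly coeff_eq_0 del: prod_constant)
    qed
  qed
  from root_moment_fps_nth[OF this assms(2)] show ?thesis using assms by simp
qed

lemma root_moment_fps_nonneg:
  assumes "d \<ge> 1" "t \<ge> 0"
  shows "fps_nth (root_moment_fps d t) n \<ge> 0"
proof (cases "n \<ge> 1")
  case True
  obtain r where r: "\<forall>k. r k > 0" "I_poly d t = (\<Prod>k=1..d. [:- r k, 1:])"
    using I_poly_splits[OF assms] by blast
  show ?thesis unfolding root_moment_fps_nth[OF r(2) True]
    using r(1) by (auto intro!: sum_nonneg divide_nonneg_nonneg simp: less_imp_le)
next
  case False
  thus ?thesis by (cases n) (simp_all add: root_moment_fps_0)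
qed

text \<open>
  The series \<open>F = I_fps d\<close> solves the heat-type equation \<open>\<partial>\<^sub>t F = (d \<vartheta> F - \<vartheta>\<^sup>2 F) / (2 d)\<close> with \<open>\<vartheta>\<close> the
  Euler operator. Its logarithmic derivative, substituted as \<open>\<vartheta> F = - d M F\<close>, therefore solves a
  Burgers equation with viscosity of order \<open>1 / d\<close>:
  \<open>\<partial>\<^sub>t M = \<vartheta> (M + M\<^sup>2 - \<vartheta> M / d) / 2\<close>.
\<close>

lemma root_moment_fps_deriv:
  assumes d: "d \<ge> 1"
  defines "M \<equiv> root_moment_fps d"
  shows "((\<lambda>s. fps_nth (M s) n) has_real_derivative
     (real n / 2 * (fps_nth (M t) n + fps_nth (M t * M t) n) - (real n)\<^sup>2 / (2 * real d) * fps_nth (M t) n)) (at t)"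
proof -
  let ?F = "I_fps d"
  define F' where "F' t = fps_const (1 / (2 * real d)) *
     (fps_const (real d) * fps_theta (?F t) - fps_theta (fps_theta (?F t)))" for t
  have F: "fps_has_deriv ?F (F' t) t" for t
    unfolding fps_has_deriv_def
  proof
    fix n
    show "((\<lambda>s. fps_nth (?F s) n) has_real_derivative fps_nth (F' t) n) (at t)"
      unfolding I_fps_def F'_def
      by (auto intro!: derivative_eq_intros simp: field_simps)
  qed
  have F0: "fps_nth (?F t) 0 = 1" for t by (simp add: I_fps_def)
  have inv: "?F t * inverse (?F t) = 1" for t using F0 by (simp add: inverse_mult_eq_1')
  have thetaF: "fps_theta (?F t) = - (fps_const (real d) * M t * ?F t)" for t
  proof -
    have "fps_const (real d) * M t * ?F t = - (fps_const (real d) * fps_const (1 / real d) * fps_theta (?F t) * (?F t * inverse (?F t)))"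
      unfolding M_def root_moment_fps_def by (simp add: mult_ac)
    also have "fps_const (real d) * fps_const (1 / real d) = (1::real fps)" using d by simp
    finally show ?thesis unfolding inv by simp
  qed
  have theta_const: "fps_theta (fps_const c * f) = fps_const c * fps_theta f" for c f
    by (rule fps_ext) simp
  have theta_minus: "fps_theta (- f) = - fps_theta f" for f
    by (rule fps_ext) simp
  \<comment> \<open>\<open>H\<close> is the logarithmic \<open>t\<close>-derivative of \<open>F\<close>, and \<open>\<partial>\<^sub>t M = - \<vartheta> H / d\<close>.\<close>
  define H where "H = fps_const (1 / 2) * (fps_theta (M t) - fps_const (real d) * (M t + M t * M t))"
  have F'H: "F' t = ?F t * H"
  proof -
    have "fps_theta (fps_theta (?F t)) = - (fps_const (real d) * (fps_theta (M t) * ?F t + M t * fps_theta (?F t)))"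
      by (subst thetaF) (simp only: theta_minus mult.assoc theta_const fps_theta_mult[of "M t"])
    also have "\<dots> = - (fps_const (real d) * fps_theta (M t) * ?F t) + fps_const (real d) * fps_const (real d) * M t * M t * ?F t"
      unfolding thetaF by (simp add: algebra_simps)
    finally have theta2: "fps_theta (fps_theta (?F t)) = \<dots>" .
    define a b where "a = fps_const (1 / (2 * real d))" and "b = fps_const (real d)"
    have "F' t = a * b * (?F t * (fps_theta (M t) - b * (M t + M t * M t)))"
      unfolding F'_def theta2 unfolding thetaF a_def[symmetric] b_def[symmetric]
      by (simp add: algebra_simps)
    hence "F' t = fps_const (1 / (2 * real d)) * fps_const (real d) * (?F t * (fps_theta (M t) - fps_const (real d) * (M t + M t * M t)))"
      unfolding a_def b_def .
    also have "fps_const (1 / (2 * real d)) * fps_const (real d) = fps_const (1 / 2)"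
      using d by simp
    finally show ?thesis unfolding H_def by (simp add: mult_ac)
  qed
  have thF': "fps_has_deriv (\<lambda>s. fps_theta (?F s)) (fps_theta (F' t)) t" for t
    using F[of t] unfolding fps_has_deriv_def by (auto intro!: DERIV_cmult)
  have "fps_has_deriv (\<lambda>s. fps_const (- 1 / real d) * (fps_theta (?F s) * inverse (?F s)))
     (0 * (fps_theta (?F t) * inverse (?F t)) + fps_const (- 1 / real d) * (fps_theta (F' t) * inverse (?F t) + fps_theta (?F t) * - (F' t * (inverse (?F t))\<^sup>2))) t"
    by (intro fps_has_deriv_mult fps_has_deriv_const thF' fps_has_deriv_inverse F F0)
  also have "(\<lambda>s. fps_const (- 1 / real d) * (fps_theta (?F s) * inverse (?F s))) = M"
    by (rule ext) (simp add: M_def root_moment_fps_def mult.assoc flip: fps_const_neg)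
  also have "0 * (fps_theta (?F t) * inverse (?F t)) + fps_const (- 1 / real d) * (fps_theta (F' t) * inverse (?F t) + fps_theta (?F t) * - (F' t * (inverse (?F t))\<^sup>2))
     = fps_const (- 1 / real d) * fps_theta H"
  proof -
    have "fps_theta (F' t) * inverse (?F t) + fps_theta (?F t) * - (F' t * (inverse (?F t))\<^sup>2)
      = fps_theta (?F t) * H * inverse (?F t) + (?F t * inverse (?F t)) * fps_theta H
         - fps_theta (?F t) * H * inverse (?F t) * (?F t * inverse (?F t))"
      unfolding F'H fps_theta_mult power2_eq_square by (simp add: algebra_simps)
    thus ?thesis unfolding inv by simp
  qed
  finally have deriv: "((\<lambda>s. fps_nth (M s) n) has_real_derivative (- 1 / real d * (real n * fps_nth H n))) (at t)"
    unfolding fps_has_deriv_def by simp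
  have Hn: "fps_nth H n = 1 / 2 * (real n * fps_nth (M t) n - real d * (fps_nth (M t) n + fps_nth (M t * M t) n))"
    unfolding H_def by (simp only: fps_mult_left_const_nth fps_sub_nth fps_add_nth fps_theta_nth)
  show ?thesis
    using deriv unfolding Hn
    by (rule DERIV_cong) (use d in \<open>simp add: field_simps power2_eq_square\<close>)
qed

section \<open>The moments of the multiplicative free semicircular law\<close>

text \<open>
  The coefficient of \<open>z ^ j\<close> in \<open>\<phi> z ^ n\<close>, where \<open>\<phi> z = (1 + z) * exp (t * z)\<close>.
\<close>

definition lagrange_coeff :: "nat \<Rightarrow> nat \<Rightarrow> real \<Rightarrow> real" where
  "lagrange_coeff n j t = (\<Sum>k\<le>j. (real n * t) ^ k / fact k * real (n choose (j - k)))"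

text \<open>
  What Lagrange inversion gives for the coefficient of \<open>y ^ n\<close> in \<open>G ^ r\<close>, where \<open>G\<close> is the power series
  solution of \<open>G = y * \<phi> G\<close>.
\<close>

definition lagrange_power_coeff :: "nat \<Rightarrow> real \<Rightarrow> nat \<Rightarrow> real" where
  "lagrange_power_coeff r t n = (if r \<le> n then real r / real n * lagrange_coeff n (n - r) t else 0)"

lemma lagrange_coeff_deriv:
  "((\<lambda>t. lagrange_coeff n (Suc j) t) has_real_derivative real n * lagrange_coeff n j t) (at t)"
proof -
  have "((\<lambda>t. lagrange_coeff n (Suc j) t) has_real_derivative
     (\<Sum>k\<le>Suc j. (real k * (real n * t) ^ (k - 1) * real n) / fact k * real (n choose (Suc j - k)))) (at t)"
    unfolding lagrange_coeff_def
    by (intro DERIV_sum) (auto intro!: derivative_eq_intros)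
  also have "(\<Sum>k\<le>Suc j. (real k * (real n * t) ^ (k - 1) * real n) / fact k * real (n choose (Suc j - k)))
      = (\<Sum>k\<le>j. real n * ((real n * t) ^ k / fact k * real (n choose (j - k))))"
  proof -
    have "real (Suc k) * (real n * t) ^ k * real n / fact (Suc k) * real (n choose (j - k))
        = real n * ((real n * t) ^ k / fact k * real (n choose (j - k)))" for k
      unfolding fact_Suc of_nat_mult by (simp del: of_nat_Suc)
    thus ?thesis unfolding sum.atMost_Suc_shift by (simp del: fact_Suc of_nat_Suc)
  qed
  also have "\<dots> = real n * lagrange_coeff n j t"
    by (simp add: lagrange_coeff_def sum_distrib_left)
  finally show ?thesis .
qed

text \<open>
  The \<open>t\<close>-derivative of \<open>\<phi> ^ n\<close> is \<open>n z \<phi> ^ n\<close>. This is the coefficient form of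
  \<open>\<partial>\<^sub>t (G ^ r) = r / (r + 1) * \<vartheta> (G ^ (r + 1))\<close>.
\<close>

lemma lagrange_power_coeff_deriv:
  "((\<lambda>t. lagrange_power_coeff r t n) has_real_derivative real r * real n / (real r + 1) * lagrange_power_coeff (Suc r) t n) (at t)"
proof (cases "Suc r \<le> n")
  case True
  then obtain j where j: "n - r = Suc j" "n - Suc r = j"
    by (metis Suc_diff_Suc Suc_le_eq)
  have "((\<lambda>t. real r / real n * lagrange_coeff n (Suc j) t) has_real_derivative
          real r / real n * (real n * lagrange_coeff n j t)) (at t)"
    by (intro DERIV_cmult lagrange_coeff_deriv)
  moreover have "real r / real n * (real n * lagrange_coeff n j t)
     = real r * real n / (real r + 1) * (real (Suc r) / real n * lagrange_coeff n j t)"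
  proof -
    have cancel: "x / b * (b * L) = x * b / a * (a / b * L)" if "a \<noteq> 0" "b \<noteq> 0" for x a b L :: real
      using that by simp
    show ?thesis using cancel[of "real r + 1" "real n"] True by (simp add: add.commute)
  qed
  ultimately show ?thesis using True j unfolding lagrange_power_coeff_def by simp
next
  case False
  have "(\<lambda>t. lagrange_power_coeff r t n) = (\<lambda>t. lagrange_power_coeff r 0 n)"
    using False by (auto simp: lagrange_power_coeff_def lagrange_coeff_def fun_eq_iff)
  hence "((\<lambda>t. lagrange_power_coeff r t n) has_real_derivative 0) (at t)" by (metis DERIV_const)
  thus ?thesis using False by (simp add: lagrange_power_coeff_def)
qed

lemma lagrange_power_coeff_at_0:
  "1 \<le> r \<Longrightarrow> r \<le> n \<Longrightarrow> lagrange_power_coeff r 0 n = real ((n - 1) choose (r - 1))"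
proof -
  assume r: "1 \<le> r" "r \<le> n"
  have "lagrange_coeff n (n - r) 0 = (\<Sum>k\<le>n-r. if k = 0 then real (n choose (n - r)) else 0)"
    unfolding lagrange_coeff_def by (intro sum.cong) auto
  also have "\<dots> = real (n choose r)" using r by (simp add: binomial_symmetric[of r n])
  finally have "lagrange_power_coeff r 0 n = real (r * (n choose r)) / real n"
    using r by (simp add: lagrange_power_coeff_def)
  also have "r * (n choose r) = n * ((n - 1) choose (r - 1))"
    using r by (intro times_binomial_minus1_eq) auto
  finally show ?thesis using r by simp
qed

text \<open>
  At \<open>t = 0\<close> the series is \<open>U = y / (1 - y)\<close>, and \<open>U = y + y U\<close> turns into Pascal's rule for the
  coefficients of its powers.
\<close>

lemma geometric_power_nth:
  assumes "1 \<le> r"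
  shows "fps_nth (Abs_fps (lagrange_power_coeff 1 0) ^ r) n = (if r \<le> n then real ((n - 1) choose (r - 1)) else 0)"
  using assms
proof (induction r arbitrary: n rule: nat_induct_at_least)
  case base
  show ?case using lagrange_power_coeff_at_0[of 1 n] by (auto simp: lagrange_power_coeff_def)
next
  case (Suc r)
  define U where "U = Abs_fps (lagrange_power_coeff 1 0)"
  have "U = fps_X + fps_X * U"
  proof (rule fps_ext)
    fix n
    show "fps_nth U n = fps_nth (fps_X + fps_X * U) n"
      using lagrange_power_coeff_at_0[of 1 n] lagrange_power_coeff_at_0[of 1 "n - 1"] unfolding U_def
      by (auto simp: lagrange_power_coeff_def)
  qed
  hence "U ^ Suc r = (fps_X + fps_X * U) * U ^ r" by simp
  hence eq: "U ^ Suc r = fps_X * U ^ r + fps_X * U ^ Suc r" by (simp add: algebra_simps)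
  note IH = Suc.IH[folded U_def] and r = \<open>1 \<le> r\<close>
  show ?case unfolding U_def[symmetric]
  proof (induction n)
    case 0
    show ?case by (subst eq) simp
  next
    case (Suc n)
    have "fps_nth (U ^ Suc r) (Suc n) = fps_nth (U ^ r) n + fps_nth (U ^ Suc r) n"
      by (subst eq) (simp del: power_Suc)
    also have "\<dots> = (if Suc r \<le> Suc n then real ((Suc n - 1) choose (Suc r - 1)) else 0)"
      unfolding IH Suc using r by (cases n; cases r) auto
    finally show ?case .
  qed
qed

text \<open>
  Lagrange inversion in the special case at hand: the series with coefficients \<open>lagrange_power_coeff r t\<close> is the \<open>r\<close>-th power
  of the one for \<open>r = 1\<close>. Both sides agree at \<open>t = 0\<close>, so it suffices to compare derivatives. The
  left-hand side has derivative \<open>r / 2 * U ^ (r - 1) * \<vartheta> V\<close>, where \<open>V\<close> is the series for exponent 2. Only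
  coefficients of \<open>V\<close> with index up to \<open>N + 1\<close> enter, so by induction on \<open>N\<close>, the excess of the index over
  the exponent, \<open>V\<close> can be replaced by \<open>U\<^sup>2\<close>. This leaves \<open>r / (r + 1) * \<vartheta> (U ^ (r + 1))\<close> at the index
  \<open>r + N\<close>, where the excess is \<open>N - 1\<close> and the induction hypothesis applies again.
\<close>

lemma lagrange_power_coeff_power:
  "1 \<le> r \<Longrightarrow> fps_nth (Abs_fps (lagrange_power_coeff 1 t) ^ r) (r + N) = lagrange_power_coeff r t (r + N)"
proof (induction N arbitrary: r t rule: less_induct)
  case (less N)
  define U where "U t = Abs_fps (lagrange_power_coeff 1 t)" for t
  define V where "V t = Abs_fps (lagrange_power_coeff 2 t)" for t
  let ?n = "r + N"
  have U0: "fps_nth (U t) 0 = 0" for t by (simp add: U_def lagrange_power_coeff_def)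
  have low: "fps_nth (U t ^ k) i = 0" if "i < k" for t k i
    using U0 that by (metis startsby_zero_power_prefix)
  have IH: "fps_nth (U t ^ k) (k + M) = lagrange_power_coeff k t (k + M)" if "M < N" "1 \<le> k" for M k t
    using less.IH[OF that] unfolding U_def .
  have dU: "fps_has_deriv U (fps_const (1/2) * fps_theta (V t)) t" for t
    unfolding fps_has_deriv_def U_def V_def
    using lagrange_power_coeff_deriv[of 1] by (simp add: numeral_2_eq_2)
  have VU: "fps_nth (V t) m = fps_nth ((U t)\<^sup>2) m" if "m \<le> N + 1" for m t
  proof (cases "m < 2")
    case True
    thus ?thesis using low[of m 2 t] by (simp add: V_def lagrange_power_coeff_def)
  next
    case False
    then obtain m' where m': "m = 2 + m'" by (metis le_add_diff_inverse not_less)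
    hence "fps_nth ((U t)\<^sup>2) (2 + m') = lagrange_power_coeff 2 t (2 + m')"
      using that by (intro IH) auto
    thus ?thesis using m' by (simp add: V_def)
  qed
  have "((\<lambda>s. fps_nth (U s ^ r) ?n) has_real_derivative
          real r * real ?n / (real r + 1) * lagrange_power_coeff (Suc r) t ?n) (at t)" for t
  proof -
    have "fps_nth (U t ^ (r - 1) * fps_theta (V t)) ?n = fps_nth (U t ^ (r - 1) * fps_theta ((U t)\<^sup>2)) ?n"
      unfolding fps_mult_nth
    proof (rule sum.cong)
      fix i assume i: "i \<in> {0..?n}"
      show "fps_nth (U t ^ (r - 1)) i * fps_nth (fps_theta (V t)) (?n - i)
          = fps_nth (U t ^ (r - 1)) i * fps_nth (fps_theta ((U t)\<^sup>2)) (?n - i)"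
      proof (cases "i < r - 1")
        case False
        \<comment> \<open>The factor of index \<open>i\<close> vanishes below \<open>r - 1\<close>, so only low coefficients of \<open>V t\<close> matter.\<close>
        hence "?n - i \<le> N + 1" by auto
        thus ?thesis by (simp add: VU)
      qed (simp add: low)
    qed simp
    also have "U t ^ (r - 1) * fps_theta ((U t)\<^sup>2) = 2 * (U t ^ r * fps_theta (U t))"
      using less.prems unfolding fps_theta_power
      by (cases r) (simp_all add: algebra_simps)
    finally have A: "fps_nth (U t ^ (r - 1) * fps_theta (V t)) ?n = 2 * fps_nth (U t ^ r * fps_theta (U t)) ?n"
      by (simp add: fps_numeral_nth_0 numeral_fps_const)
    have "fps_theta (U t ^ Suc r) = fps_const (real (Suc r)) * (U t ^ r * fps_theta (U t))"
      unfolding fps_theta_power by (simp add: fps_of_nat mult.assoc del: of_nat_Suc)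
    hence B: "real ?n * fps_nth (U t ^ Suc r) ?n = real (Suc r) * fps_nth (U t ^ r * fps_theta (U t)) ?n"
      by (metis fps_mult_left_const_nth fps_theta_nth)
    have C: "fps_nth (U t ^ Suc r) ?n = lagrange_power_coeff (Suc r) t ?n"
    proof (cases N)
      case 0
      thus ?thesis using low[of r "Suc r" t] by (simp add: lagrange_power_coeff_def del: power_Suc)
    next
      case (Suc M)
      thus ?thesis using IH[of M "Suc r" t] by (simp del: power_Suc)
    qed
    have "fps_nth (of_nat r * U t ^ (r - 1) * (fps_const (1/2) * fps_theta (V t))) ?n
        = real r / 2 * fps_nth (U t ^ (r - 1) * fps_theta (V t)) ?n"
    proof -
      have "of_nat r * U t ^ (r - 1) * (fps_const (1/2) * fps_theta (V t))
        = fps_const (real r / 2) * (U t ^ (r - 1) * fps_theta (V t))"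
        by (simp add: fps_of_nat[symmetric] mult_ac)
      thus ?thesis by (metis fps_mult_left_const_nth)
    qed
    also have "\<dots> = real r * real ?n / (real r + 1) * lagrange_power_coeff (Suc r) t ?n"
    proof -
      have "real r * real ?n / (real r + 1) * lagrange_power_coeff (Suc r) t ?n
          = real r * (real ?n * lagrange_power_coeff (Suc r) t ?n) / (real r + 1)" by simp
      also have "\<dots> = real r * (real (Suc r) * fps_nth (U t ^ r * fps_theta (U t)) ?n) / real (Suc r)"
        using B unfolding C by (simp add: add.commute)
      also have "\<dots> = real r * fps_nth (U t ^ r * fps_theta (U t)) ?n"
        by (simp del: of_nat_Suc)
      finally show ?thesis unfolding A by simp
    qed
    finally show ?thesis
      using fps_has_deriv_power[OF dU, of r t] unfolding fps_has_deriv_def by metis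
  qed
  hence "\<forall>t. ((\<lambda>s. fps_nth (U s ^ r) ?n - lagrange_power_coeff r s ?n) has_real_derivative 0) (at t)"
    using DERIV_diff[OF _ lagrange_power_coeff_deriv[of r ?n]] by force
  hence "fps_nth (U t ^ r) ?n - lagrange_power_coeff r t ?n = fps_nth (U 0 ^ r) ?n - lagrange_power_coeff r 0 ?n"
    by (rule DERIV_isconst_all)
  also have "\<dots> = 0"
    using geometric_power_nth[OF less.prems, of ?n] lagrange_power_coeff_at_0[OF less.prems, of ?n]
    unfolding U_def by simp
  finally show ?case unfolding U_def by simp
qed

text \<open>
  The moments of the multiplicative free semicircular law. The value at \<open>n = 0\<close> is 0 and not the total
  mass 1, so that the generating series starts with \<open>y\<close> as \<open>root_moment_fps\<close> does.
\<close>

definition semicircular_moment :: "nat \<Rightarrow> real \<Rightarrow> real" where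
  "semicircular_moment n t = exp (real n * t / 2) * lagrange_power_coeff 1 t n"

lemma semicircular_moment_eq:
  assumes "n \<ge> 1"
  shows "semicircular_moment n t = exp (real n * t / 2) *
          (\<Sum>k<n. real n powi (int k - 1) / fact k * real (n choose (k + 1)) * t ^ k)"
proof -
  have "lagrange_power_coeff 1 t n = (\<Sum>k\<le>n-1. 1 / real n * ((real n * t) ^ k / fact k * real (n choose (n - 1 - k))))"
    using assms by (simp add: lagrange_power_coeff_def lagrange_coeff_def sum_distrib_left)
  also have "\<dots> = (\<Sum>k<n. real n powi (int k - 1) / fact k * real (n choose (k + 1)) * t ^ k)"
  proof (rule sum.cong)
    show "{..n - 1} = {..<n}" using assms by auto
    fix k assume "k \<in> {..<n}"
    hence "n choose (k + 1) = n choose (n - 1 - k)"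
      by (subst binomial_symmetric) auto
    moreover have "real n powi (int k - 1) = real n ^ k / real n"
      using assms by (simp add: power_int_diff)
    ultimately show "1 / real n * ((real n * t) ^ k / fact k * real (n choose (n - 1 - k)))
        = real n powi (int k - 1) / fact k * real (n choose (k + 1)) * t ^ k"
      by (simp add: power_mult_distrib)
  qed
  finally show ?thesis by (simp add: semicircular_moment_def)
qed

text \<open>
  This is the equation of \<open>root_moment_fps_deriv\<close> with the term of order \<open>1 / d\<close> removed: the inviscid
  Burgers equation.
\<close>

lemma semicircular_moment_deriv:
  "((\<lambda>t. semicircular_moment n t) has_real_derivative
     real n / 2 * (semicircular_moment n t
       + (\<Sum>i=0..n. semicircular_moment i t * semicircular_moment (n - i) t))) (at t)"
proof -
  have sq: "lagrange_power_coeff 2 t n = (\<Sum>i=0..n. lagrange_power_coeff 1 t i * lagrange_power_coeff 1 t (n - i))"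
  proof -
    have "fps_nth (Abs_fps (lagrange_power_coeff 1 t) ^ 2) n = lagrange_power_coeff 2 t n"
    proof (cases "n < 2")
      case True
      have "fps_nth (Abs_fps (lagrange_power_coeff 1 t)) 0 = 0" by (simp add: lagrange_power_coeff_def)
      with True have "fps_nth (Abs_fps (lagrange_power_coeff 1 t) ^ 2) n = 0"
        by (metis startsby_zero_power_prefix)
      thus ?thesis using True by (simp add: lagrange_power_coeff_def)
    next
      case False
      then obtain m where "n = 2 + m" by (metis le_add_diff_inverse not_less)
      thus ?thesis using lagrange_power_coeff_power[of 2 t m] by simp
    qed
    thus ?thesis by (simp add: power2_eq_square fps_mult_nth)
  qed
  have "(\<Sum>i=0..n. semicircular_moment i t * semicircular_moment (n - i) t)
      = (\<Sum>i=0..n. exp (real n * t / 2) * (lagrange_power_coeff 1 t i * lagrange_power_coeff 1 t (n - i)))"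
  proof (rule sum.cong)
    fix i assume "i \<in> {0..n}"
    hence "exp (real n * t / 2) = exp (real i * t / 2) * exp (real (n - i) * t / 2)"
      by (simp add: exp_add[symmetric] of_nat_diff field_simps)
    thus "semicircular_moment i t * semicircular_moment (n - i) t
       = exp (real n * t / 2) * (lagrange_power_coeff 1 t i * lagrange_power_coeff 1 t (n - i))"
      by (simp add: semicircular_moment_def)
  qed simp
  hence S: "(\<Sum>i=0..n. semicircular_moment i t * semicircular_moment (n - i) t)
     = exp (real n * t / 2) * lagrange_power_coeff 2 t n"
    unfolding sq by (simp add: sum_distrib_left)
  show ?thesis unfolding S unfolding semicircular_moment_def
    by (rule DERIV_cong[OF DERIV_mult[OF _ lagrange_power_coeff_deriv]])
       (auto intro!: derivative_eq_intros simp: field_simps numeral_2_eq_2)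
qed

lemma semicircular_moment_0 [simp]: "semicircular_moment 0 t = 0"
  by (simp add: semicircular_moment_def lagrange_power_coeff_def)

lemma semicircular_moment_at_0: "n \<ge> 1 \<Longrightarrow> semicircular_moment n 0 = 1"
  using lagrange_power_coeff_at_0[of 1 n] by (simp add: semicircular_moment_def)

text \<open>
  Geometric growth of the moments is what confines the limit law, and all the roots, to a compact
  interval.
\<close>

lemma semicircular_moment_bounds:
  assumes t: "t \<ge> 0"
  shows "0 \<le> semicircular_moment n t" "semicircular_moment n t \<le> (2 * exp (3 * t / 2)) ^ n"
proof -
  have L0: "0 \<le> lagrange_coeff n j t" for j
    unfolding lagrange_coeff_def using t by (intro sum_nonneg) auto
  show "0 \<le> semicircular_moment n t"
    unfolding semicircular_moment_def lagrange_power_coeff_def using L0 by auto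
  show "semicircular_moment n t \<le> (2 * exp (3 * t / 2)) ^ n"
  proof (cases "n = 0")
    case False
    have L: "lagrange_coeff n j t \<le> 2 ^ n * exp (real n * t)" for j
    proof -
      have "lagrange_coeff n j t \<le> (\<Sum>k\<le>j. (real n * t) ^ k / fact k * 2 ^ n)"
        unfolding lagrange_coeff_def
      proof (intro sum_mono mult_left_mono)
        fix k
        have "n choose (j - k) \<le> 2 ^ n" by (rule binomial_le_pow2)
        thus "real (n choose (j - k)) \<le> 2 ^ n" by (metis of_nat_le_iff of_nat_numeral of_nat_power)
      qed (use t in auto)
      also have "\<dots> = (\<Sum>k\<le>j. (real n * t) ^ k / fact k) * 2 ^ n" by (simp add: sum_distrib_right)
      also have "(\<Sum>k\<le>j. (real n * t) ^ k / fact k) \<le> exp (real n * t)"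
      proof -
        have "(\<lambda>k. (real n * t) ^ k / fact k) sums exp (real n * t)"
          using exp_converges[of "real n * t"] by (simp add: divide_inverse mult.commute)
        thus ?thesis using t
          by (metis (no_types, lifting) divide_nonneg_pos fact_gt_zero finite_atMost mult_nonneg_nonneg
              of_nat_0_le_iff sum_le_suminf sums_summable sums_unique zero_le_power)
      qed
      finally show ?thesis by (simp add: mult.commute)
    qed
    have "semicircular_moment n t \<le> exp (real n * t / 2) * (2 ^ n * exp (real n * t))"
      unfolding semicircular_moment_def
    proof (intro mult_left_mono)
      have "1 / real n * lagrange_coeff n (n - 1) t \<le> 1 * lagrange_coeff n (n - 1) t"
        using False L0 by (intro mult_right_mono) auto
      thus "lagrange_power_coeff 1 t n \<le> 2 ^ n * exp (real n * t)"
        using L[of "n - 1"] L0[of "n - 1"] unfolding lagrange_power_coeff_def by auto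
    qed auto
    also have "\<dots> = (2 * exp (3 * t / 2)) ^ n"
      by (simp add: power_mult_distrib exp_of_nat_mult[symmetric] exp_add[symmetric] field_simps)
    finally show ?thesis .
  qed simp
qed

section \<open>Convergence of moments and a uniform bound on the roots\<close>

lemma DERIV_le_imp_le_linear:
  fixes f :: "real \<Rightarrow> real"
  assumes "f 0 = 0" "0 \<le> t"
    and "\<And>s. (f has_real_derivative f' s) (at s)"
    and b: "\<And>s. 0 \<le> s \<Longrightarrow> s \<le> t \<Longrightarrow> f' s \<le> b"
  shows "f t \<le> b * t"
proof (cases "t = 0")
  case False
  with assms obtain z where z: "0 < z" "z < t" "f t - f 0 = (t - 0) * f' z"
    using MVT2[of 0 t f f'] by auto
  have "t * f' z \<le> t * b"
    using b[of z] z assms(2) by (intro mult_left_mono) auto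
  thus ?thesis using z assms(1) by (simp add: mult.commute)
qed (use assms in simp)

text \<open>
  Induction on \<open>n\<close>, since the two moment equations are triangular: apart from the \<open>n\<close>-th moment itself
  they contain products of lower moments only. The difference \<open>D\<close> of the \<open>n\<close>-th moments vanishes at
  \<open>t = 0\<close>. After multiplication by the integrating factor \<open>exp (- n t / 2)\<close>, its derivative is
  nonnegative, because the viscous term slows the root moments down and the lower root moments do not
  exceed the limiting ones by induction, and it is \<open>O(1 / d)\<close> on
  \<open>{0..T}\<close>. The lower bound of the induction is used as well: it bounds the root moments by those of the
  limit law, uniformly in \<open>d\<close>.
\<close>

theorem root_moments_converge:
  assumes T: "T \<ge> 0"
  shows "\<exists>A\<ge>0. \<forall>d\<ge>1. \<forall>t\<in>{0..T}.
    0 \<le> semicircular_moment n t - fps_nth (root_moment_fps d t) n \<and>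
    semicircular_moment n t - fps_nth (root_moment_fps d t) n \<le> A / real d"
proof (induction n rule: less_induct)
  case (less n)
  let ?m = semicircular_moment and ?M = "\<lambda>d t. fps_nth (root_moment_fps d t)"
  show ?case
  proof (cases "n = 0")
    case True
    thus ?thesis by (intro exI[of _ 0]) (auto simp: root_moment_fps_0)
  next
    case n: False
    have "\<forall>i. \<exists>A. i < n \<longrightarrow> A \<ge> 0 \<and> (\<forall>d\<ge>1. \<forall>t\<in>{0..T}. 0 \<le> ?m i t - ?M d t i \<and> ?m i t - ?M d t i \<le> A / real d)"
      using less by blast
    then obtain A where A: "\<And>i. i < n \<Longrightarrow> A i \<ge> 0"
      "\<And>i d t. i < n \<Longrightarrow> d \<ge> 1 \<Longrightarrow> 0 \<le> t \<Longrightarrow> t \<le> T \<Longrightarrow> 0 \<le> ?m i t - ?M d t i \<and> ?m i t - ?M d t i \<le> A i / real d"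
      unfolding choice_iff by (metis atLeastAtMost_iff)
    define C where "C = 2 * exp (3 * T / 2)"
    have C: "?m i t \<le> C ^ i" if "0 \<le> t" "t \<le> T" for i t
      using that
      by (intro order_trans[OF semicircular_moment_bounds(2)[OF that(1), of i]]) (auto simp: C_def intro!: power_mono)
    have C0: "C \<ge> 0" by (simp add: C_def)
    define S where "S t = (\<Sum>i=0..n. ?m i t * ?m (n - i) t)" for t
    define R where "R d t = (\<Sum>i=0..n. ?M d t i * ?M d t (n - i))" for d t
    define f where "f d t = exp (- (real n / 2 * t)) * (?m n t - ?M d t n)" for d t
    define f' where "f' d t = exp (- (real n / 2 * t)) *
       (real n / 2 * (S t - R d t) + (real n)\<^sup>2 / (2 * real d) * ?M d t n)" for d t
    have f0: "f d 0 = 0" if "d \<ge> 1" for d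
      using n that by (simp add: f_def semicircular_moment_at_0 root_moment_fps_at_0)
    have df: "(f d has_real_derivative f' d t) (at t)" if "d \<ge> 1" for d t
    proof -
      have "((\<lambda>t. ?m n t - ?M d t n) has_real_derivative
         real n / 2 * (?m n t + S t) - (real n / 2 * (?M d t n + R d t) - (real n)\<^sup>2 / (2 * real d) * ?M d t n)) (at t)"
        using DERIV_diff[OF semicircular_moment_deriv[of n t] root_moment_fps_deriv[OF that, of n t]]
        unfolding S_def R_def fps_mult_nth .
      moreover have "((\<lambda>t. exp (- (real n / 2 * t))) has_real_derivative exp (- (real n / 2 * t)) * (- (real n / 2))) (at t)"
        by (auto intro!: derivative_eq_intros)
      ultimately show ?thesis
        unfolding f_def[abs_def] f'_def
        by (rule DERIV_cong[OF DERIV_mult[rotated]]) (use that in \<open>simp add: field_simps\<close>)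
    qed
    \<comment> \<open>The zeroth coefficients vanish, so the \<open>n\<close>-th moment does not occur in the quadratic terms.\<close>
    have SR: "S t - R d t = (\<Sum>i=1..<n. ?m i t * ?m (n - i) t - ?M d t i * ?M d t (n - i))" for d t
    proof -
      have "S t - R d t = (\<Sum>i=0..n. ?m i t * ?m (n - i) t - ?M d t i * ?M d t (n - i))"
        unfolding S_def R_def by (simp add: sum_subtractf)
      also have "\<dots> = (\<Sum>i=1..<n. ?m i t * ?m (n - i) t - ?M d t i * ?M d t (n - i))"
      proof (rule sum.mono_neutral_right)
        show "\<forall>i\<in>{0..n} - {1..<n}. ?m i t * ?m (n - i) t - ?M d t i * ?M d t (n - i) = 0"
        proof
          fix i assume "i \<in> {0..n} - {1..<n}"
          hence "i = 0 \<or> i = n" by auto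
          thus "?m i t * ?m (n - i) t - ?M d t i * ?M d t (n - i) = 0"
            by (auto simp: root_moment_fps_0)
        qed
      qed auto
      finally show ?thesis .
    qed
    define K where "K = (\<Sum>i=1..<n. A i * C ^ (n - i) + C ^ i * A (n - i))"
    have prod_diff: "0 \<le> ?m i t * ?m (n - i) t - ?M d t i * ?M d t (n - i)"
      "?m i t * ?m (n - i) t - ?M d t i * ?M d t (n - i) \<le> (A i * C ^ (n - i) + C ^ i * A (n - i)) / real d"
      if i: "i \<in> {1..<n}" and d: "d \<ge> 1" and t: "0 \<le> t" "t \<le> T" for i d t
    proof -
      have i': "i < n" "n - i < n" using i by auto
      note a = A(2)[OF i'(1) d t] and b = A(2)[OF i'(2) d t]
      note Mi = root_moment_fps_nonneg[OF d t(1), of i] and Mj = root_moment_fps_nonneg[OF d t(1), of "n - i"]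
      show "0 \<le> ?m i t * ?m (n - i) t - ?M d t i * ?M d t (n - i)"
        using a b Mi Mj by (auto intro: mult_mono)
      have "?m i t * ?m (n - i) t - ?M d t i * ?M d t (n - i)
         = (?m i t - ?M d t i) * ?m (n - i) t + ?M d t i * (?m (n - i) t - ?M d t (n - i))"
        by (simp add: algebra_simps)
      also have "\<dots> \<le> A i / real d * C ^ (n - i) + C ^ i * (A (n - i) / real d)"
      proof (intro add_mono mult_mono)
        show "?M d t i \<le> C ^ i" using a C[OF t, of i] by linarith
      qed (use a b C[OF t] C0 A(1)[OF i'(1)] semicircular_moment_bounds(1)[OF t(1)] in auto)
      finally show "?m i t * ?m (n - i) t - ?M d t i * ?M d t (n - i) \<le> (A i * C ^ (n - i) + C ^ i * A (n - i)) / real d"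
        by (simp add: add_divide_distrib)
    qed
    have SR0: "0 \<le> S t - R d t" and SRK: "S t - R d t \<le> K / real d"
      if "d \<ge> 1" "0 \<le> t" "t \<le> T" for d t
    proof -
      show "0 \<le> S t - R d t" unfolding SR using prod_diff(1) that by (intro sum_nonneg) auto
      show "S t - R d t \<le> K / real d" unfolding SR K_def sum_divide_distrib
        using prod_diff(2) that by (intro sum_mono) auto
    qed
    have f'0: "0 \<le> f' d t" if "d \<ge> 1" "0 \<le> t" "t \<le> T" for d t
      unfolding f'_def using SR0[OF that] root_moment_fps_nonneg[OF that(1,2), of n]
      by (intro mult_nonneg_nonneg add_nonneg_nonneg) auto
    have lower: "0 \<le> ?m n t - ?M d t n" if "d \<ge> 1" "0 \<le> t" "t \<le> T" for d t
    proof -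
      have "- f d t \<le> 0 * t"
        by (rule DERIV_le_imp_le_linear[where f' = "\<lambda>s. - f' d s"])
           (use that f'0 f0 df in \<open>auto intro: DERIV_minus\<close>)
      thus ?thesis by (simp add: f_def zero_le_mult_iff)
    qed
    define B where "B = real n / 2 * K + (real n)\<^sup>2 / 2 * C ^ n"
    have K0: "K \<ge> 0" unfolding K_def using A(1) C0 by (intro sum_nonneg add_nonneg_nonneg mult_nonneg_nonneg) auto
    hence B0: "B \<ge> 0" unfolding B_def using C0 by (intro add_nonneg_nonneg mult_nonneg_nonneg) auto
    have f'B: "f' d t \<le> B / real d" if "d \<ge> 1" "0 \<le> t" "t \<le> T" for d t
    proof -
      have M: "?M d t n \<le> C ^ n" using lower[OF that] C[OF that(2,3), of n] by linarith
      have "f' d t \<le> 1 * (real n / 2 * (S t - R d t) + (real n)\<^sup>2 / (2 * real d) * ?M d t n)"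
        unfolding f'_def using that SR0[OF that] root_moment_fps_nonneg[OF that(1,2), of n]
        by (intro mult_right_mono add_nonneg_nonneg mult_nonneg_nonneg) auto
      also have "\<dots> \<le> real n / 2 * (K / real d) + (real n)\<^sup>2 / (2 * real d) * C ^ n"
        using SRK[OF that] M by (simp only: mult_1) (intro add_mono mult_left_mono, auto)
      also have "\<dots> = B / real d" unfolding B_def by (simp add: add_divide_distrib)
      finally show ?thesis .
    qed
    have upper: "?m n t - ?M d t n \<le> exp (real n / 2 * T) * (B * T) / real d"
      if "d \<ge> 1" "0 \<le> t" "t \<le> T" for d t
    proof -
      have "f d t \<le> B / real d * t"
        by (rule DERIV_le_imp_le_linear[where f' = "f' d"]) (use that f'B f0 df in auto)
      also have "\<dots> \<le> B * T / real d" using that B0 by (simp add: divide_right_mono mult_left_mono)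
      finally have "exp (real n / 2 * t) * f d t \<le> exp (real n / 2 * T) * (B * T / real d)"
        using that B0 T lower[OF that] by (intro mult_mono) (auto simp: f_def mult_left_mono)
      moreover have "exp (real n / 2 * t) * f d t = ?m n t - ?M d t n"
        by (simp add: f_def mult.assoc[symmetric] exp_minus)
      ultimately show ?thesis by simp
    qed
    show ?thesis
      using lower upper T B0 by (intro exI[of _ "exp (real n / 2 * T) * (B * T)"]) auto
  qed
qed

lemma root_moment_le:
  assumes "d \<ge> 1" "t \<ge> 0"
  shows "fps_nth (root_moment_fps d t) n \<le> semicircular_moment n t"
  using root_moments_converge[OF assms(2), of n] assms by auto

lemma root_moment_tendsto:
  assumes t: "t \<ge> 0"
  shows "(\<lambda>d. fps_nth (root_moment_fps d t) n) \<longlonglongrightarrow> semicircular_moment n t"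
proof -
  obtain A where A: "\<And>d. d \<ge> 1 \<Longrightarrow> 0 \<le> semicircular_moment n t - fps_nth (root_moment_fps d t) n \<and>
      semicircular_moment n t - fps_nth (root_moment_fps d t) n \<le> A / real d"
    using root_moments_converge[OF t, of n] t by (metis atLeastAtMost_iff order_refl)
  have "(\<lambda>d. semicircular_moment n t - fps_nth (root_moment_fps d t) n) \<longlonglongrightarrow> 0"
  proof (rule tendsto_sandwich[OF _ _ tendsto_const])
    show "(\<lambda>d. A / real d) \<longlonglongrightarrow> 0"
      by (rule lim_const_over_n)
  qed (use A in \<open>auto intro!: eventually_sequentiallyI[of 1]\<close>)
  from tendsto_diff[OF tendsto_const[of "semicircular_moment n t"] this] show ?thesis by simp
qed

text \<open>
  The \<open>n\<close>-th power of the largest root is at most \<open>d\<close> times the \<open>n\<close>-th moment, hence at most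
  \<open>d * C ^ n\<close> for every \<open>n\<close>. Letting \<open>n\<close> grow removes the factor \<open>d\<close>, so that the bound is uniform in
  the degree.
\<close>

lemma I_poly_roots_le:
  assumes d: "d \<ge> 1" and t: "t \<ge> 0" and r: "\<And>k. r k > 0" "I_poly d t = (\<Prod>k=1..d. [:- r k, 1:])"
    and k: "k \<in> {1..d}"
  shows "r k \<le> 2 * exp (3 * t / 2)"
proof (rule ccontr)
  define C where "C = 2 * exp (3 * t / 2)"
  assume "\<not> r k \<le> 2 * exp (3 * t / 2)"
  hence q: "1 < r k / C" "C > 0" by (auto simp: C_def)
  then obtain n where n: "real d < (r k / C) ^ n" using real_arch_pow by blast
  hence n0: "n \<noteq> 0" using d by (intro notI) simp
  have "r k ^ n \<le> (\<Sum>k=1..d. r k ^ n)"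
    using k r(1) by (intro member_le_sum) (auto simp: less_imp_le)
  also have "\<dots> = real d * fps_nth (root_moment_fps d t) n"
    using root_moment_fps_nth[OF r(2), of n] n0 d by simp
  also have "\<dots> \<le> real d * C ^ n"
    using root_moment_le[OF d t, of n] semicircular_moment_bounds(2)[OF t, of n]
    unfolding C_def by (intro mult_left_mono) auto
  finally have "(r k / C) ^ n \<le> real d"
    using q by (simp add: power_divide divide_le_eq)
  with n show False by simp
qed

section \<open>Weak convergence of the root distributions\<close>

text \<open>
  On a bounded interval the Taylor remainder of the characteristic function is at most
  \<open>2 (\<bar>t\<bar> R) ^ n / n!\<close>.
\<close>

lemma char_eq_moment_series:
  assumes M: "real_distribution M" and R: "R \<ge> 0" "AE x in M. \<bar>x\<bar> \<le> R"
  shows "(\<lambda>n. \<Sum>k\<le>n. (\<i> * of_real t) ^ k / fact k * of_real (\<integral>x. x ^ k \<partial>M)) \<longlonglongrightarrow> char M t"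
proof -
  interpret real_distribution M by fact
  have int: "integrable M (\<lambda>x. x ^ k)" for k
  proof (rule integrable_const_bound[where B = "R ^ k"])
    show "AE x in M. norm (x ^ k) \<le> R ^ k"
      using R(2) by eventually_elim (simp add: power_abs power_mono)
  qed simp
  have bound: "norm (char M t - (\<Sum>k\<le>n. (\<i> * of_real t) ^ k / fact k * of_real (\<integral>x. x ^ k \<partial>M)))
      \<le> 2 * ((\<bar>t\<bar> * R) ^ n / fact n)" for n
  proof -
    have "expectation (\<lambda>x. \<bar>x\<bar> ^ n) \<le> R ^ n"
    proof (rule integral_le_const)
      show "integrable M (\<lambda>x. \<bar>x\<bar> ^ n)"
        using integrable_abs[OF int[of n]] by (simp add: power_abs)
      show "AE x in M. \<bar>x\<bar> ^ n \<le> R ^ n"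
        using R(2) by eventually_elim (simp add: power_mono)
    qed
    hence "(2 * \<bar>t\<bar> ^ n / fact n) * expectation (\<lambda>x. \<bar>x\<bar> ^ n) \<le> (2 * \<bar>t\<bar> ^ n / fact n) * R ^ n"
      by (intro mult_left_mono) auto
    moreover note char_approx1[of n t, OF int]
    ultimately show ?thesis by (simp add: power_mult_distrib)
  qed
  have "(\<lambda>n. (\<bar>t\<bar> * R) ^ n / fact n) \<longlonglongrightarrow> 0"
    using summable_LIMSEQ_zero[OF summable_exp[of "\<bar>t\<bar> * R"]] by (simp add: divide_inverse mult.commute)
  from tendsto_mult_right_zero[OF this, of 2]
  have "(\<lambda>n. char M t - (\<Sum>k\<le>n. (\<i> * of_real t) ^ k / fact k * of_real (\<integral>x. x ^ k \<partial>M))) \<longlonglongrightarrow> 0"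
    by (rule Lim_null_comparison[rotated]) (use bound in auto)
  from tendsto_diff[OF tendsto_const[of "char M t"] this] show ?thesis by simp
qed

lemma bounded_moments_determine:
  assumes "real_distribution M1" "real_distribution M2" "R \<ge> 0"
    and "AE x in M1. \<bar>x\<bar> \<le> R" "AE x in M2. \<bar>x\<bar> \<le> R"
    and mom: "\<And>n. n \<ge> 1 \<Longrightarrow> (\<integral>x. x ^ n \<partial>M1) = (\<integral>x. x ^ n \<partial>M2)"
  shows "M1 = M2"
proof (rule Levy_uniqueness[OF assms(1,2)], rule ext)
  fix t
  interpret M1: real_distribution M1 by fact
  interpret M2: real_distribution M2 by fact
  have "(\<integral>x. x ^ n \<partial>M1) = (\<integral>x. x ^ n \<partial>M2)" for n
    using mom[of n] M1.prob_space M2.prob_space by (cases n) auto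
  thus "char M1 t = char M2 t"
    using char_eq_moment_series[OF assms(1,3,4), of t] char_eq_moment_series[OF assms(2,3,5), of t]
    by (simp add: LIMSEQ_unique)
qed

lemma compact_supported_imp_AE_bounded:
  assumes M: "real_distribution M" and K: "compact K" "measure M K = 1"
  obtains R where "R \<ge> 0" "AE x in M. \<bar>x\<bar> \<le> R"
proof -
  interpret real_distribution M by fact
  obtain R where R: "\<And>x. x \<in> K \<Longrightarrow> norm x \<le> R"
    using compact_imp_bounded[OF K(1)] unfolding bounded_iff by blast
  have "K \<in> events" using K(1) by (simp add: borel_compact)
  hence "AE x in M. x \<in> K" using K(2) prob_eq_1 by blast
  hence "AE x in M. \<bar>x\<bar> \<le> max 0 R" by eventually_elim (use R in fastforce)
  thus thesis by (intro that[of "max 0 R"]) auto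
qed

text \<open>
  Weak convergence controls integrals of bounded continuous functions. Testing with the distance to
  the interval \<open>{0..C}\<close>, cut off at 1, shows that the limit lives on that interval, and there powers
  agree with the bounded functions \<open>c x ^ k\<close>, where \<open>c\<close> is the projection onto the interval.
\<close>

lemma weak_limit_bounded:
  assumes \<mu>: "\<And>n. real_distribution (\<mu> n)" and M: "real_distribution M" and w: "weak_conv_m \<mu> M"
    and supp: "\<And>n. AE x in \<mu> n. x \<in> {0..C}" and C: "C \<ge> 0"
  shows "AE x in M. x \<in> {0..C}"
    and "(\<lambda>n. \<integral>x. x ^ k \<partial>\<mu> n) \<longlonglongrightarrow> (\<integral>x. x ^ k \<partial>M)"
proof -
  interpret M: real_distribution M by fact
  interpret \<mu>: real_distribution "\<mu> n" for n by fact
  define c where "c x = max 0 (min C x)" for x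
  have c_id: "c x = x" if "x \<in> {0..C}" for x using that by (auto simp: c_def)
  have c_cont: "isCont c x" for x unfolding c_def by (intro continuous_intros)
  define h where "h x = min 1 \<bar>x - c x\<bar>" for x
  have h_cont: "isCont h x" for x unfolding h_def by (intro continuous_intros c_cont)
  have [measurable]: "h \<in> borel_measurable borel" "c \<in> borel_measurable borel"
    unfolding h_def c_def by measurable
  have "(\<lambda>n. integral\<^sup>L (\<mu> n) h) \<longlonglongrightarrow> integral\<^sup>L M h"
    by (rule weak_conv_imp_integral_bdd_continuous_conv[OF \<mu> M w, of h 1])
       (auto simp: h_cont, auto simp: h_def)
  moreover have "integral\<^sup>L (\<mu> n) h = 0" for n
    by (rule integral_eq_zero_AE) (use supp[of n] in \<open>eventually_elim, simp add: h_def c_id\<close>)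
  ultimately have "integral\<^sup>L M h = 0"
    by (simp add: LIMSEQ_const_iff)
  moreover have "integrable M h"
    by (rule M.integrable_const_bound[where B = 1]) (auto simp: h_def)
  moreover have "AE x in M. 0 \<le> h x" by (auto simp: h_def)
  ultimately have "AE x in M. h x = 0"
    using integral_nonneg_eq_0_iff_AE by blast
  thus AE: "AE x in M. x \<in> {0..C}"
    by eventually_elim (use C in \<open>auto simp: h_def c_def min_def max_def split: if_splits\<close>)
  have "(\<lambda>n. integral\<^sup>L (\<mu> n) (\<lambda>x. c x ^ k)) \<longlonglongrightarrow> integral\<^sup>L M (\<lambda>x. c x ^ k)"
  proof (rule weak_conv_imp_integral_bdd_continuous_conv[OF \<mu> M w])
    show "isCont (\<lambda>x. c x ^ k) x" for x by (intro continuous_intros c_cont)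
    show "norm (c x ^ k) \<le> C ^ k" for x
      using C by (auto simp: c_def norm_power intro!: power_mono)
  qed
  moreover have "integral\<^sup>L (\<mu> n) (\<lambda>x. c x ^ k) = (\<integral>x. x ^ k \<partial>\<mu> n)" for n
  proof (rule integral_cong_AE)
    show "AE x in \<mu> n. c x ^ k = x ^ k" using supp[of n] by eventually_elim (simp add: c_id)
  qed auto
  moreover have "integral\<^sup>L M (\<lambda>x. c x ^ k) = (\<integral>x. x ^ k \<partial>M)"
  proof (rule integral_cong_AE)
    show "AE x in M. c x ^ k = x ^ k" using AE by eventually_elim (simp add: c_id)
  qed auto
  ultimately show "(\<lambda>n. \<integral>x. x ^ k \<partial>\<mu> n) \<longlonglongrightarrow> (\<integral>x. x ^ k \<partial>M)" by simp
qed

lemma tight_bounded: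
  assumes \<mu>: "\<And>n. real_distribution (\<mu> n)"
    and supp: "\<And>n. AE x in \<mu> n. x \<in> {0..C}" and C: "C \<ge> 0"
  shows "tight \<mu>"
  unfolding tight_def
proof (intro conjI allI impI \<mu>)
  fix \<epsilon> :: real assume \<epsilon>: "\<epsilon> > 0"
  have "measure (\<mu> n) {-1<..C} > 1 - \<epsilon>" for n
  proof -
    interpret real_distribution "\<mu> n" by fact
    have "AE x in \<mu> n. x \<in> {-1<..C}" using supp[of n] by eventually_elim auto
    hence "prob {-1<..C} = 1" by (subst prob_eq_1) auto
    thus ?thesis using \<epsilon> by simp
  qed
  thus "\<exists>a b. a < b \<and> (\<forall>n. measure (\<mu> n) {a<..b} > 1 - \<epsilon>)"
    using C by (intro exI[of _ "-1"] exI[of _ C]) auto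
qed

text \<open>
  The method of moments on a compact interval. A limit law exists by tightness; the moments of any
  subsequential limit are the limits \<open>m k\<close>, and on a bounded interval they determine the law, so all
  subsequential limits coincide.
\<close>

theorem moments_converge_imp_weak_conv:
  assumes \<mu>: "\<And>n. real_distribution (\<mu> n)"
    and supp: "\<And>n. AE x in \<mu> n. x \<in> {0..C}" and C: "C \<ge> 0"
    and mom: "\<And>k. k \<ge> 1 \<Longrightarrow> (\<lambda>n. \<integral>x. x ^ k \<partial>\<mu> n) \<longlonglongrightarrow> m k"
  obtains M where "real_distribution M" "AE x in M. x \<in> {0..C}"
    "\<And>k. k \<ge> 1 \<Longrightarrow> (\<integral>x. x ^ k \<partial>M) = m k" "weak_conv_m \<mu> M"
proof -
  have tight: "tight \<mu>" by (rule tight_bounded[OF \<mu> supp C])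
  have sub: "(AE x in \<nu>. x \<in> {0..C}) \<and> (\<forall>k\<ge>1. (\<integral>x. x ^ k \<partial>\<nu>) = m k)"
    if "strict_mono s" "real_distribution \<nu>" "weak_conv_m (\<mu> \<circ> s) \<nu>" for s \<nu>
  proof (intro conjI allI impI)
    note wl = weak_limit_bounded[of "\<mu> \<circ> s", OF _ that(2,3) _ C]
    show "AE x in \<nu>. x \<in> {0..C}" by (rule wl(1)) (simp_all only: o_apply \<mu> supp)
    fix k :: nat assume "k \<ge> 1"
    have "(\<lambda>n. \<integral>x. x ^ k \<partial>(\<mu> \<circ> s) n) \<longlonglongrightarrow> (\<integral>x. x ^ k \<partial>\<nu>)" by (rule wl(2)) (simp_all only: o_apply \<mu> supp)
    moreover have "(\<lambda>n. \<integral>x. x ^ k \<partial>(\<mu> \<circ> s) n) \<longlonglongrightarrow> m k"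
      using LIMSEQ_subseq_LIMSEQ[OF mom[OF \<open>k \<ge> 1\<close>] that(1)] by (simp add: o_def)
    ultimately show "(\<integral>x. x ^ k \<partial>\<nu>) = m k" by (rule LIMSEQ_unique)
  qed
  obtain r M where r: "strict_mono (r :: nat \<Rightarrow> nat)" "real_distribution M" "weak_conv_m (\<mu> \<circ> id \<circ> r) M"
    using tight_imp_convergent_subsubsequence[OF tight strict_mono_id] by blast
  have M: "(AE x in M. x \<in> {0..C}) \<and> (\<forall>k\<ge>1. (\<integral>x. x ^ k \<partial>M) = m k)"
    using r by (intro sub[of r]) auto
  have "weak_conv_m \<mu> M"
  proof (rule tight_subseq_weak_converge[OF \<mu> r(2) tight])
    fix s \<nu> assume s: "strict_mono s" "real_distribution \<nu>" "weak_conv_m (\<mu> \<circ> s) \<nu>"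
    note N = sub[OF s]
    have "\<nu> = M"
    proof (rule bounded_moments_determine[OF s(2) r(2) C])
      show "AE x in \<nu>. \<bar>x\<bar> \<le> C" using conjunct1[OF N] by eventually_elim auto
      show "AE x in M. \<bar>x\<bar> \<le> C" using conjunct1[OF M] by eventually_elim auto
    qed (use N M in auto)
    thus "weak_conv_m (\<mu> \<circ> s) M" using s by simp
  qed
  thus thesis using that r(2) M by blast
qed

lemma real_distribution_root_dist: "real_distribution (root_dist p)"
  unfolding root_dist_def by (rule prob_space.real_distribution_distr[OF prob_space_measure_pmf]) simp

lemma root_dist_prod_linear:
  assumes p: "p = (\<Prod>k=1..d. [:- r k, 1:])" and d: "d \<ge> 1"
  shows "(\<integral>x. x ^ n \<partial>root_dist p) = (1 / real d) * (\<Sum>k=1..d. r k ^ n)"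
    and "AE x in root_dist p. x \<in> r ` {1..d}"
proof -
  have roots: "proots p = image_mset r (mset_set {1..d})"
    unfolding p by (subst proots_prod) (auto simp: sum_unfold_sum_mset)
  have ne: "proots p \<noteq> {#}" using d by (auto simp: roots mset_set_empty_iff)
  have eq: "pmf_of_multiset (proots p) = map_pmf r (pmf_of_set {1..d})"
    unfolding roots using d by (intro map_pmf_of_set[symmetric]) auto
  have "(\<integral>x. x ^ n \<partial>root_dist p) = (\<integral>x. x ^ n \<partial>measure_pmf (pmf_of_multiset (proots p)))"
    unfolding root_dist_def by (subst integral_distr) auto
  also have "\<dots> = measure_pmf.expectation (pmf_of_set {1..d}) (\<lambda>k. r k ^ n)"
    unfolding eq by simp
  also have "\<dots> = (1 / real d) * (\<Sum>k=1..d. r k ^ n)"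
    using d by (subst integral_pmf_of_set) auto
  finally show "(\<integral>x. x ^ n \<partial>root_dist p) = (1 / real d) * (\<Sum>k=1..d. r k ^ n)" .
  have "AE x in measure_pmf (pmf_of_multiset (proots p)). x \<in> r ` {1..d}"
    using ne by (auto simp: AE_measure_pmf_iff roots)
  thus "AE x in root_dist p. x \<in> r ` {1..d}"
    unfolding root_dist_def by (subst AE_distr_iff) (auto intro!: borel_closed finite_imp_closed)
qed

text \<open>
  The definite description behind \<open>mult_free_semicircular\<close> denotes a law only once existence and
  uniqueness are known: the given \<open>M\<close> provides the former, moment determinacy the latter.
\<close>

lemma mult_free_semicircular_eqI:
  assumes M: "real_distribution M" "AE x in M. x \<in> {0..C}"
    and mom: "\<And>n. n \<ge> 1 \<Longrightarrow> (\<integral>x. x ^ n \<partial>M) = semicircular_moment n t"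
  shows "mult_free_semicircular t = M"
  unfolding mult_free_semicircular_def
proof (rule the_equality)
  interpret M: real_distribution M by fact
  have "M.prob {0..C} = 1" using M(2) by (subst M.prob_eq_1) auto
  thus "real_distribution M \<and> (\<exists>K. compact K \<and> K \<subseteq> {0..} \<and> M.prob K = 1) \<and>
      (\<forall>n\<ge>1. (\<integral>x. x ^ n \<partial>M) = exp (real n * t / 2) *
          (\<Sum>k<n. real n powi (int k - 1) / fact k * real (n choose (k + 1)) * t ^ k))"
    using M(1) mom semicircular_moment_eq by (auto intro!: exI[of _ "{0..C}"])
next
  fix N assume N: "real_distribution N \<and> (\<exists>K. compact K \<and> K \<subseteq> {0..} \<and> measure N K = 1) \<and>
      (\<forall>n\<ge>1. (\<integral>x. x ^ n \<partial>N) = exp (real n * t / 2) *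
          (\<Sum>k<n. real n powi (int k - 1) / fact k * real (n choose (k + 1)) * t ^ k))"
  then obtain K where K: "compact K" "measure N K = 1" by blast
  obtain R where R: "R \<ge> 0" "AE x in N. \<bar>x\<bar> \<le> R"
    using compact_supported_imp_AE_bounded[OF _ K] N by blast
  show "N = M"
  proof (rule bounded_moments_determine)
    show "AE x in N. \<bar>x\<bar> \<le> max R C" using R(2) by eventually_elim auto
    show "AE x in M. \<bar>x\<bar> \<le> max R C" using M(2) by eventually_elim auto
    show "(\<integral>x. x ^ n \<partial>N) = (\<integral>x. x ^ n \<partial>M)" if "n \<ge> 1" for n
      using N mom[OF that] semicircular_moment_eq[OF that] that by simp
  qed (use N M R in auto)
qed

text \<open>
  The degree is shifted by one because the polynomial of degree 0 has no roots, and
  \<open>root_dist\<close> of it carries no information.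
\<close>

theorem I_poly_roots_weak_conv:
  assumes t: "t \<ge> 0"
  shows "weak_conv_m (\<lambda>d. root_dist (I_poly d t)) (mult_free_semicircular t)"
proof -
  define C where "C = 2 * exp (3 * t / 2)"
  define \<mu> where "\<mu> d = root_dist (I_poly (Suc d) t)" for d
  have \<mu>: "real_distribution (\<mu> d)" for d
    unfolding \<mu>_def by (rule real_distribution_root_dist)
  have root: "(AE x in \<mu> d. x \<in> {0..C}) \<and>
      (\<forall>n\<ge>1. (\<integral>x. x ^ n \<partial>\<mu> d) = fps_nth (root_moment_fps (Suc d) t) n)" for d
  proof -
    obtain r where r: "\<And>k. r k > 0" "I_poly (Suc d) t = (\<Prod>k=1..Suc d. [:- r k, 1:])"
      using I_poly_splits[of "Suc d" t] t by auto
    have "r ` {1..Suc d} \<subseteq> {0..C}"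
      using I_poly_roots_le[OF _ t r] r(1) unfolding C_def by (auto simp: less_imp_le)
    moreover have "AE x in \<mu> d. x \<in> r ` {1..Suc d}"
      unfolding \<mu>_def using root_dist_prod_linear(2)[OF r(2)] by simp
    ultimately have "AE x in \<mu> d. x \<in> {0..C}"
      by (auto elim!: eventually_mono)
    moreover have "(\<integral>x. x ^ n \<partial>\<mu> d) = fps_nth (root_moment_fps (Suc d) t) n" if "n \<ge> 1" for n
      unfolding \<mu>_def using root_dist_prod_linear(1)[OF r(2), of n] root_moment_fps_nth[OF r(2) that] by simp
    ultimately show ?thesis by blast
  qed
  have mom: "(\<lambda>d. \<integral>x. x ^ n \<partial>\<mu> d) \<longlonglongrightarrow> semicircular_moment n t" if "n \<ge> 1" for n
    using LIMSEQ_Suc[OF root_moment_tendsto[OF t, of n]] root that by simp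
  obtain M where M: "real_distribution M" "AE x in M. x \<in> {0..C}"
    "\<And>n. n \<ge> 1 \<Longrightarrow> (\<integral>x. x ^ n \<partial>M) = semicircular_moment n t" "weak_conv_m \<mu> M"
    by (rule moments_converge_imp_weak_conv[of \<mu> C "\<lambda>n. semicircular_moment n t"])
       (use \<mu> root mom in \<open>auto simp: C_def\<close>)
  have "mult_free_semicircular t = M" by (rule mult_free_semicircular_eqI[OF M(1-3)])
  thus ?thesis
    using M(4) unfolding weak_conv_m_def weak_conv_def \<mu>_def
    by (auto simp: filterlim_sequentially_Suc[where f = "\<lambda>d. cdf (root_dist (I_poly d t)) x" for x])
qed

theorem theorem1p3:
  shows "(\<forall>(d::nat) (\<theta>::nat \<Rightarrow> real) (\<sigma>::real) (p::real poly).
            d \<ge> 2 \<longrightarrow>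
            p = (\<Prod>k=1..d. [:- exp (\<theta> k), 1:]) \<longrightarrow>
            (1 / real d) * (\<Sum>k=1..d. \<theta> k) = 0 \<longrightarrow>
            (1 / real d) * (\<Sum>k=1..d. (\<theta> k)\<^sup>2) = \<sigma>\<^sup>2 \<longrightarrow>
            (\<forall>j. (\<lambda>m. coeff (ffmc_power d (root_power (1 / sqrt (real m)) p) m) j)
                   \<longlonglongrightarrow> coeff (I_poly d (real d * \<sigma>\<^sup>2 / (real d - 1))) j))
       \<and> (\<forall>t::real. t \<ge> 0 \<longrightarrow>
            (\<forall>d\<ge>1. \<exists>r::nat \<Rightarrow> real. I_poly d t = (\<Prod>k=1..d. [:- r k, 1:])) \<and>
            weak_conv_m (\<lambda>d. root_dist (I_poly d t)) (mult_free_semicircular t))"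
proof (intro conjI allI impI, goal_cases)
  case (1 d \<theta> \<sigma> p j)
  have "(\<Sum>k=1..d. \<theta> k) = 0" "(\<Sum>k=1..d. (\<theta> k)\<^sup>2) = real d * \<sigma>\<^sup>2"
    using 1 by (auto simp: field_simps)
  with 1(1,2) show ?case by (rule finite_free_central_limit)
next
  case (2 t d)
  thus ?case using I_poly_splits by blast
next
  case (3 t)
  thus ?case by (rule I_poly_roots_weak_conv)
qed

end
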